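(* Consider the level $(1,N)$ Fock representation $\mathcal F^{(1,N)}_u$ of $\mathcal U_{q,t,p}$ ($\gamma=(t/q)^{1/2}$, $p^*=pq/t$). Set, for $m\neq0$, $$s^+_m=\frac{(t/q)^{m/2}}{1-(t/q)^m}\alpha_m,\qquad s^-_m=\frac{(t/q)^{m/2}}{1-(t/q)^m}\alpha'_m,\qquad y_m=\frac{1-p^m}{\kappa_m}(t/q)^{-m/2}\alpha'_m,\qquad Y(u)=\;:\exp\Big\{\sum_{m\ne0}y_mu^{-m}\Big\}:.$$ Then: (a) $$[s^+_m,s^+_n]=-\frac1m\frac{1-p^m}{1-p^{*m}}(1-q^m)(1-t^{-m})\delta_{m+n,0},\qquad[s^-_m,s^-_n]=-\frac1m\frac{1-p^{*-m}}{1-p^{-m}}(1-q^m)(1-t^{-m})\delta_{m+n,0},$$ and the elliptic currents are the screening currents $$x^\pm((t/q)^{1/4}z)=\big((t/q)^{N/2}u/z^N\big)^{\pm1}:\exp\Big\{\pm\sum_{m\ne0}s^\pm_mz^{-m}\Big\}:.$$ (b) $$[y_m,y_n]=-\frac1m\frac{(1-p^{*m})(1-p^{-m})}{(1-q^m)(1-t^{-m})}\delta_{m+n,0}.$$ (c) For every partition $\lambda$, writing $\widetilde\Phi^*_\lambda(u)=\,:\widetilde\Phi_\lambda(p^{-1}u)^{-1}:$, $$:\widetilde\Phi^*_\lambda(u)\widetilde\Phi_\lambda(u):\;=\;:\prod_{\square\in A(\lambda)}Y(u/q^\square)\prod_{\blacksquare\in R(\lambda)}Y((q/t)u/q^\b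lacksquare)^{-1}:.$$
   Context: $q,t$ generic nonzero complex numbers, $p$ generic with $|p|<1$, $|pq/t|<1$; $\kappa_m=(1-q^m)(1-t^{-m})(1-(t/q)^m)$. The level $(1,N)$ Fock space of the elliptic quantum toroidal algebra is $\mathcal F^{(1,N)}_u=\mathbb C[\alpha_{-m}\,(m>0)]1_u^{(N)}$ with $[\alpha_m,\alpha_n]=-\frac{\kappa_m}{m}(1-(q/t)^m)\frac{1-p^m}{1-p^{*m}}\delta_{m+n,0}$, $p^*=pq/t$, $\alpha_m1^{(N)}_u=0$ for $m>0$, $\alpha'_m=\frac{1-p^{*m}}{1-p^m}(t/q)^{m/2}\alpha_m$, and currents $$x^+(z)=uz^{-N}(t/q)^{3N/4}\exp\Big\{-\sum_{n>0}\tfrac{(t/q)^{n/4}}{1-(t/q)^n}\alpha_{-n}z^n\Big\}\exp\Big\{\sum_{n>0}\tfrac{(t/q)^{3n/4}}{1-(t/q)^n}\alpha_nz^{-n}\Big\},$$ $$x^-(z)=u^{-1}z^N(t/q)^{-3N/4}\exp\Big\{\sum_{n>0}\tfrac{(t/q)^{n/4}}{1-(t/q)^n}\alpha'_{-n}z^n\Big\}\exp\Big\{-\sum_{n>0}\tfrac{(t/q)^{3n/4}}{1-(t/q)^n}\alpha'_nz^{-n}\Big\}.$$ $:\ :$ is normal ordering. The operator part of the type I vertex operator is $$\widetilde\Phi_\lambda(u)=\;:\Phi_\emptyset(u)\prod_{(i,j)\in\lambda}\widetilde x^-\big((t/q)^{1/4}q^{j-1}t^{-i+1}u\big):,\qquad\Phi_\emptyset(u)=\exp\Big\{-\sum_{m>0}\tfrac1{\kappa_m}\alpha'_{-m}((t/q)^{1/2}u)^m\Big\}\exp\Big\{\sum_{m>0}\tfrac1{\kappa_m}\alpha'_m((t/q)^{1/2}u)^{-m}\Big\},$$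 where $\widetilde x^-(z)$ is $x^-(z)$ without the prefactor $u^{-1}z^N(t/q)^{-3N/4}$. $A(\lambda)$, $R(\lambda)$ are the sets of addable and removable boxes of $\lambda$, and $q^\square=t^{i-1}q^{-j+1}$ for $\square=(i,j)$ (row $i$, column $j$). *)

theory Defs
  imports Complex_Main "HOL-Library.Multiset" "HOL-Library.Poly_Mapping"
    "HOL-Computational_Algebra.Formal_Power_Series"
begin

text \<open>
  Throughout, \<open>r\<close> is a fixed fourth root of \<open>t / q\<close>, so that \<open>(t/q)\<^sup>k\<^sup>/\<^sup>4\<close> is \<open>r powi k\<close>.
\<close>

section \<open>The Fock space and the Heisenberg operators\<close>

text \<open>
  \<open>\<complex>[\<alpha>\<^bsub>-m\<^esub> (m > 0)]\<close> as the monoid algebra of the free commutative monoid on the variables;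
  the index \<open>k :: nat\<close> stands for the variable \<open>\<alpha>\<^bsub>-(k+1)\<^esub>\<close>, and \<open>1\<close> is the vacuum \<open>1\<^sub>u\<close>.
\<close>
type_synonym fock = "nat multiset \<Rightarrow>\<^sub>0 complex"

definition smul :: "complex \<Rightarrow> ('a \<Rightarrow>\<^sub>0 complex) \<Rightarrow> 'a \<Rightarrow>\<^sub>0 complex" where
  "smul c v = Poly_Mapping.map (\<lambda>x. c * x) v"

definition fock_deriv :: "nat \<Rightarrow> fock \<Rightarrow> fock" where
  "fock_deriv k v =
     (\<Sum>M\<in>Poly_Mapping.keys v.
        Poly_Mapping.single (M - {#k#}) (of_nat (count M k) * Poly_Mapping.lookup v M))"

definition pstar :: "complex \<Rightarrow> complex \<Rightarrow> complex \<Rightarrow> complex" where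
  "pstar q t p = p * q / t"

definition kappa :: "complex \<Rightarrow> complex \<Rightarrow> int \<Rightarrow> complex" where
  "kappa q t m = (1 - q powi m) * (1 - t powi (-m)) * (1 - (t / q) powi m)"

text \<open>The value of \<open>[\<alpha>\<^bsub>m\<^esub>, \<alpha>\<^bsub>-m\<^esub>]\<close>.\<close>
definition heis :: "complex \<Rightarrow> complex \<Rightarrow> complex \<Rightarrow> int \<Rightarrow> complex" where
  "heis q t p m = - (kappa q t m / of_int m) * (1 - (q / t) powi m)
                    * ((1 - p powi m) / (1 - pstar q t p powi m))"

text \<open>There is no \<open>\<alpha>\<^sub>0\<close>; the value at \<open>0\<close> is a dummy.\<close>
definition alpha_op :: "complex \<Rightarrow> complex \<Rightarrow> complex \<Rightarrow> int \<Rightarrow> fock \<Rightarrow> fock" where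
  "alpha_op q t p m v =
     (if m < 0 then Poly_Mapping.single {#nat (-m) - 1#} 1 * v
      else if m > 0 then smul (heis q t p m) (fock_deriv (nat m - 1) v)
      else 0)"

definition commutator :: "(fock \<Rightarrow> fock) \<Rightarrow> (fock \<Rightarrow> fock) \<Rightarrow> fock \<Rightarrow> fock" where
  "commutator A B v = A (B v) - B (A v)"

text \<open>The operators above satisfy the defining relations of the Fock representation.\<close>

lemma lookup_smul [simp]: "Poly_Mapping.lookup (smul c v) M = c * Poly_Mapping.lookup v M"
  by (simp add: smul_def Poly_Mapping.map.rep_eq when_def)

lemma lookup_fock_deriv:
  "Poly_Mapping.lookup (fock_deriv k v) M =
     of_nat (Suc (count M k)) * Poly_Mapping.lookup v (add_mset k M)"
proof -
  have eq: "(if M' - {#k#} = M then of_nat (count M' k) * c else 0) =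
      (if M' = add_mset k M then of_nat (Suc (count M k)) * c else (0::complex))" for M' c
    by (cases "k \<in># M'") (auto simp: not_in_iff dest: multi_member_split)
  have "Poly_Mapping.lookup (fock_deriv k v) M =
      (\<Sum>M'\<in>Poly_Mapping.keys v. if M' - {#k#} = M
         then of_nat (count M' k) * Poly_Mapping.lookup v M' else 0)"
    by (simp add: fock_deriv_def lookup_sum lookup_single when_def)
  also have "\<dots> = of_nat (Suc (count M k)) * Poly_Mapping.lookup v (add_mset k M)"
    unfolding eq by (simp add: sum.delta in_keys_iff del: of_nat_Suc)
  finally show ?thesis .
qed

lemma lookup_mult_var:
  fixes v :: fock
  shows "Poly_Mapping.lookup (Poly_Mapping.single {#j#} 1 * v) M =
     (if j \<in># M then Poly_Mapping.lookup v (M - {#j#}) else 0)"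
proof -
  have "Poly_Mapping.lookup (Poly_Mapping.single {#j#} 1 * v) M =
      (\<Sum>l. (\<Sum>k. Poly_Mapping.lookup v k when M = {#j#} + k) when l = {#j#})"
    unfolding lookup_mult lookup_single by (rule Sum_any.cong) (simp add: when_def)
  also have "\<dots> = (\<Sum>k. Poly_Mapping.lookup v k when M = {#j#} + k)"
    by simp
  also have "\<dots> = (if j \<in># M then Poly_Mapping.lookup v (M - {#j#}) else 0)"
  proof (cases "j \<in># M")
    case True
    then obtain L where L: "M = add_mset j L" by (metis mset_add)
    have "(\<Sum>k. Poly_Mapping.lookup v k when M = {#j#} + k) = (\<Sum>k. Poly_Mapping.lookup v k when k = L)"
      by (rule Sum_any.cong) (auto simp: L when_def)
    then show ?thesis by (simp add: L)
  next
    case False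
    then have "\<And>k. M \<noteq> {#j#} + k" by auto
    with False show ?thesis by simp
  qed
  finally show ?thesis .
qed

lemma alpha_op_vacuum: "m > 0 \<Longrightarrow> alpha_op q t p m 1 = 0"
  by (rule poly_mapping_eqI) (simp add: alpha_op_def lookup_fock_deriv lookup_one)

lemma commutator_deriv_var:
  fixes v :: fock
  shows "fock_deriv k (Poly_Mapping.single {#j#} 1 * v) - Poly_Mapping.single {#j#} 1 * fock_deriv k v
    = (if j = k then v else 0)"
proof (rule poly_mapping_eqI)
  fix M
  show "Poly_Mapping.lookup (fock_deriv k (Poly_Mapping.single {#j#} 1 * v)
          - Poly_Mapping.single {#j#} 1 * fock_deriv k v) M
      = Poly_Mapping.lookup (if j = k then v else 0) M"
  proof (cases "j \<in># M")
    case True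
    then obtain L where "M = add_mset j L" by (metis mset_add)
    then show ?thesis
      by (auto simp: lookup_minus lookup_fock_deriv lookup_mult_var add_mset_commute ring_distribs)
  next
    case False
    then show ?thesis
      by (auto simp: lookup_minus lookup_fock_deriv lookup_mult_var count_eq_zero_iff)
  qed
qed

lemma heis_uminus:
  assumes "q \<noteq> 0" "t \<noteq> 0" "p \<noteq> 0" "m \<noteq> 0" "p powi m \<noteq> 1" "pstar q t p powi m \<noteq> 1"
  shows "heis q t p (-m) = - heis q t p m"
proof -
  define Q T P where "Q = q powi m" and "T = t powi m" and "P = p powi m"
  have nz: "Q \<noteq> 0" "T \<noteq> 0" "P \<noteq> 0" "P \<noteq> 1" "P * Q / T \<noteq> 1"
    using assms by (auto simp: Q_def T_def P_def pstar_def power_int_mult_distrib power_int_divide_distrib)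
  from nz(5) have nz5: "P * Q \<noteq> T" using nz by auto
  have e: "heis q t p m = - ((1 - Q) * (1 - inverse T) * (1 - T / Q) / of_int m) * (1 - Q / T)
       * ((1 - P) / (1 - P * Q / T))"
    by (simp add: heis_def kappa_def pstar_def Q_def T_def P_def power_int_mult_distrib
        power_int_divide_distrib power_int_minus)
  have e': "heis q t p (-m) = ((1 - inverse Q) * (1 - T) * (1 - Q / T) / of_int m) * (1 - T / Q)
       * ((1 - inverse P) / (1 - T / (P * Q)))"
    by (simp add: heis_def kappa_def pstar_def Q_def T_def P_def power_int_mult_distrib
        power_int_divide_distrib power_int_minus field_simps)
  show ?thesis unfolding e e' using nz nz5 assms(4)
    by (simp add: divide_simps) (intro disjI2, simp add: algebra_simps)
qed

lemma alpha_op_commutator: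
  assumes "q \<noteq> 0" "t \<noteq> 0" "p \<noteq> 0" "m \<noteq> 0" "n \<noteq> 0"
    and "\<And>k. k \<noteq> 0 \<Longrightarrow> p powi k \<noteq> 1" "\<And>k. k \<noteq> 0 \<Longrightarrow> pstar q t p powi k \<noteq> 1"
  shows "commutator (alpha_op q t p m) (alpha_op q t p n) v =
    smul (- (kappa q t m / of_int m) * (1 - (q / t) powi m)
           * ((1 - p powi m) / (1 - pstar q t p powi m)) * (if m + n = 0 then 1 else 0)) v"
proof -
  have smul_var: "Poly_Mapping.single {#j#} 1 * smul c w = smul c (Poly_Mapping.single {#j#} 1 * w)"
    for j c and w :: fock
    by (rule poly_mapping_eqI) (simp add: lookup_mult_var)
  have smul_deriv: "fock_deriv k (smul c w) = smul c (fock_deriv k w)" for k c w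
    by (rule poly_mapping_eqI) (simp add: lookup_fock_deriv)
  have smul_diff: "smul c w - smul c w' = smul c (w - w')" for c and w w' :: fock
    by (rule poly_mapping_eqI) (simp add: lookup_minus algebra_simps)
  have smul_0: "smul c (0::fock) = 0" "smul 0 w = 0" for c and w :: fock
    by (rule poly_mapping_eqI; simp)+
  have main: "commutator (alpha_op q t p a) (alpha_op q t p b) w =
      smul (heis q t p a * (if a + b = 0 then 1 else 0)) w" if "a > 0" "b < 0" for a b w
  proof -
    have eq: "(nat (-b) - 1 = nat a - 1) = (a + b = 0)" using that by auto
    show ?thesis
      using that commutator_deriv_var[of "nat a - 1" "nat (-b) - 1" w]
      unfolding eq by (auto simp: commutator_def alpha_op_def smul_var smul_diff smul_0)
  qed
  have anti: "commutator A B w = - commutator B A w" for A B w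
    by (simp add: commutator_def)
  consider "m > 0" "n > 0" | "m < 0" "n < 0" | "m > 0" "n < 0" | "m < 0" "n > 0"
    using assms by linarith
  then show ?thesis
  proof cases
    case 1
    then show ?thesis
      by (auto simp: commutator_def alpha_op_def smul_0 intro!: poly_mapping_eqI)
         (simp add: lookup_minus lookup_fock_deriv add_mset_commute)
  next
    case 2
    then show ?thesis
      by (simp add: commutator_def alpha_op_def smul_0 mult.left_commute)
  next
    case 3
    then show ?thesis using main[of m n v] by (simp add: heis_def)
  next
    case 4
    have "smul (heis q t p n * (if n + m = 0 then 1 else 0)) v =
        - smul (heis q t p m * (if m + n = 0 then 1 else 0)) v"
    proof (cases "m + n = 0")
      case True
      then have "n = - m" by simp
      with heis_uminus[of q t p m] assms have "heis q t p n = - heis q t p m" by simp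
      with True show ?thesis by (auto intro!: poly_mapping_eqI simp: add.commute)
    next
      case False
      then show ?thesis by (simp add: smul_0 add.commute)
    qed
    then show ?thesis using main[of n m v] anti[of "alpha_op q t p m"] 4 by (simp add: heis_def)
  qed
qed


section \<open>Symbols and normal ordering\<close>

text \<open>
  Inside a normal ordered product the modes \<open>\<alpha>\<^sub>m\<close> are treated as commuting symbols.
  Such an expression is a polynomial in the \<open>\<alpha>\<^sub>m\<close>, \<open>m \<in> \<int> - {0}\<close>; normal ordering sends a monomial
  to the composition of its factors with all creation operators (\<open>m < 0\<close>) to the left of
  all annihilation operators (\<open>m > 0\<close>). Sorting the indices increasingly achieves this;
  the order among modes of equal sign is immaterial as these commute.
\<close>
type_synonym sym = "int multiset \<Rightarrow>\<^sub>0 complex"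

definition alpha :: "int \<Rightarrow> sym" where
  "alpha m = Poly_Mapping.single {#m#} 1"

definition normal_ordered :: "complex \<Rightarrow> complex \<Rightarrow> complex \<Rightarrow> sym \<Rightarrow> fock \<Rightarrow> fock" where
  "normal_ordered q t p P v =
     (\<Sum>M\<in>Poly_Mapping.keys P.
        smul (Poly_Mapping.lookup P M)
          (foldr (alpha_op q t p) (sorted_list_of_multiset M) v))"

text \<open>In particular a linear combination of modes is the same as its normal ordering.\<close>

lemma normal_ordered_linear:
  "normal_ordered q t p (smul c (alpha m)) v = smul c (alpha_op q t p m v)"
proof (cases "c = 0")
  case True
  then have "smul c (alpha m) = 0" by (auto intro: poly_mapping_eqI)
  with True show ?thesis by (auto simp: normal_ordered_def intro: poly_mapping_eqI)
next
  case False
  have "smul c (alpha m) = Poly_Mapping.single {#m#} c"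
    by (rule poly_mapping_eqI) (simp add: alpha_def lookup_single when_def)
  with False show ?thesis by (simp add: normal_ordered_def)
qed

text \<open>
  Formal series in the spectral parameter \<open>u\<close> whose coefficients are symbols. Series infinite in
  both directions cannot be multiplied, so \<open>u\<close> (carried by creation modes) and \<open>w = u\<^sup>-\<^sup>1\<close> (carried by
  annihilation modes) are kept apart until normal ordering has been applied: the outer
  variable is \<open>u\<close>, the inner one is \<open>w\<close>.
\<close>
type_synonym symser = "sym fps fps"

definition coef :: "symser \<Rightarrow> nat \<Rightarrow> nat \<Rightarrow> sym" where
  "coef F a b = fps_nth (fps_nth F a) b"

text \<open>\<open>\<Sum>\<^bsub>n>0\<^esub> f\<^sub>n u\<^sup>n\<close> and \<open>\<Sum>\<^bsub>n>0\<^esub> f\<^sub>n u\<^sup>-\<^sup>n\<close>\<close>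

definition pos_series :: "(nat \<Rightarrow> sym) \<Rightarrow> symser" where
  "pos_series f = Abs_fps (\<lambda>a. if a = 0 then 0 else fps_const (f a))"

definition neg_series :: "(nat \<Rightarrow> sym) \<Rightarrow> symser" where
  "neg_series f = fps_const (Abs_fps (\<lambda>b. if b = 0 then 0 else f b))"

text \<open>\<open>\<Sum>\<^bsub>m\<noteq>0\<^esub> f\<^sub>m u\<^sup>-\<^sup>m\<close>\<close>

definition two_sided :: "(int \<Rightarrow> sym) \<Rightarrow> symser" where
  "two_sided f = pos_series (\<lambda>n. f (- int n)) + neg_series (\<lambda>n. f (int n))"

text \<open>
  \<open>\<Sum>\<^sub>k A\<^sup>k / k!\<close> for \<open>A\<close> without constant term: then \<open>A\<^sup>k\<close> has no terms of total degree below \<open>k\<close>.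
\<close>
definition sym_exp :: "symser \<Rightarrow> symser" where
  "sym_exp A = Abs_fps (\<lambda>a. Abs_fps (\<lambda>b. \<Sum>k\<le>a + b. smul (1 / fact k) (coef (A ^ k) a b)))"

definition sym_inv :: "symser \<Rightarrow> symser" where
  "sym_inv F = (THE G. F * G = 1)"

lemma sym_inv_eq:
  assumes "F * G = 1"
  shows "sym_inv F = G"
  unfolding sym_inv_def
proof (rule the_equality)
  fix H assume H: "F * H = 1"
  have "H = H * (F * G)" unfolding assms by (rule mult_1_right [symmetric])
  also have "\<dots> = (F * H) * G" by (simp only: mult.assoc mult.left_commute)
  also have "\<dots> = G" unfolding H by (rule mult_1_left)
  finally show "H = G" .
qed (rule assms)

text \<open>The substitution \<open>u \<mapsto> c u\<close>.\<close>

definition sym_arg :: "complex \<Rightarrow> symser \<Rightarrow> symser" where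
  "sym_arg c F = Abs_fps (\<lambda>a. Abs_fps (\<lambda>b. smul (c ^ a * inverse c ^ b) (coef F a b)))"

text \<open>
  An operator valued formal distribution \<open>\<Sum>\<^sub>n V\<^sub>n z\<^sup>n\<close> on the Fock space is the family of its
  modes \<open>V\<^sub>n\<close>.
\<close>
type_synonym dist = "int \<Rightarrow> fock \<Rightarrow> fock"

text \<open>
  Normal ordering of a series. For the series below the coefficient of \<open>u\<^sup>a w\<^sup>b\<close> lowers
  the degree by \<open>b\<close> before raising it by \<open>a\<close>, so only finitely many \<open>b\<close> contribute
  on a given vector.
\<close>
definition nord :: "complex \<Rightarrow> complex \<Rightarrow> complex \<Rightarrow> symser \<Rightarrow> dist" where
  "nord q t p F n v =
     (\<Sum>b. if n + int b \<ge> 0 then normal_ordered q t p (coef F (nat (n + int b)) b) v else 0)"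


section \<open>Operator valued series\<close>

text \<open>One-sided series \<open>\<Sum>\<^bsub>n\<ge>0\<^esub> A\<^sub>n x\<^sup>n\<close>, where \<open>x\<close> is \<open>z\<close> or \<open>z\<^sup>-\<^sup>1\<close>\<close>

type_synonym opser = "nat \<Rightarrow> fock \<Rightarrow> fock"

primrec op_power :: "opser \<Rightarrow> nat \<Rightarrow> opser" where
  "op_power A 0 = (\<lambda>n v. if n = 0 then v else 0)"
| "op_power A (Suc k) = (\<lambda>n v. \<Sum>i\<le>n. A i (op_power A k (n - i) v))"

definition op_exp :: "opser \<Rightarrow> opser" where
  "op_exp A n v = (\<Sum>k\<le>n. smul (1 / fact k) (op_power A k n v))"

text \<open>\<open>\<Sum>\<^bsub>n>0\<^esub> f\<^sub>n x\<^sup>n\<close> for modes \<open>f\<^sub>n\<close>\<close>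

definition op_series :: "complex \<Rightarrow> complex \<Rightarrow> complex \<Rightarrow> (nat \<Rightarrow> sym) \<Rightarrow> opser" where
  "op_series q t p f n v = (if n = 0 then 0 else normal_ordered q t p (f n) v)"

text \<open>The product \<open>C(z) D(z\<^sup>-\<^sup>1)\<close>\<close>

definition op_product :: "opser \<Rightarrow> opser \<Rightarrow> dist" where
  "op_product C D n v = (\<Sum>b. if n + int b \<ge> 0 then C (nat (n + int b)) (D b v) else 0)"

text \<open>\<open>V(c z)\<close> and \<open>c z\<^sup>k V(z)\<close>\<close>

definition dist_arg :: "complex \<Rightarrow> dist \<Rightarrow> dist" where
  "dist_arg c V n v = smul (c powi n) (V n v)"

definition dist_monom :: "complex \<Rightarrow> int \<Rightarrow> dist \<Rightarrow> dist" where
  "dist_monom c k V n v = smul c (V (n - k) v)"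


section \<open>Elliptic currents, screening currents and vertex operators\<close>

definition alpha' :: "complex \<Rightarrow> complex \<Rightarrow> complex \<Rightarrow> complex \<Rightarrow> int \<Rightarrow> sym" where
  "alpha' q t p r m = smul ((1 - pstar q t p powi m) / (1 - p powi m) * r powi (2 * m)) (alpha m)"

definition x_plus :: "complex \<Rightarrow> complex \<Rightarrow> complex \<Rightarrow> complex \<Rightarrow> int \<Rightarrow> complex \<Rightarrow> dist" where
  "x_plus q t p r N u = dist_monom (u * r powi (3 * N)) (-N)
     (op_product
       (op_exp (op_series q t p (\<lambda>n. smul (- (r ^ n / (1 - (t / q) ^ n))) (alpha (- int n)))))
       (op_exp (op_series q t p (\<lambda>n. smul (r ^ (3 * n) / (1 - (t / q) ^ n)) (alpha (int n))))))"

text \<open>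
  The modes in the two exponents of \<open>x\<^sup>-(z)\<close>; they are used both for the operator \<open>x\<^sup>-(z)\<close> and for
  the symbol of its prefactor-free version, which occurs inside normal ordered products.
\<close>
definition x_minus_cre :: "complex \<Rightarrow> complex \<Rightarrow> complex \<Rightarrow> complex \<Rightarrow> nat \<Rightarrow> sym" where
  "x_minus_cre q t p r n = smul (r ^ n / (1 - (t / q) ^ n)) (alpha' q t p r (- int n))"

definition x_minus_ann :: "complex \<Rightarrow> complex \<Rightarrow> complex \<Rightarrow> complex \<Rightarrow> nat \<Rightarrow> sym" where
  "x_minus_ann q t p r n = smul (- (r ^ (3 * n) / (1 - (t / q) ^ n))) (alpha' q t p r (int n))"

definition x_minus :: "complex \<Rightarrow> complex \<Rightarrow> complex \<Rightarrow> complex \<Rightarrow> int \<Rightarrow> complex \<Rightarrow> dist" where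
  "x_minus q t p r N u = dist_monom (inverse u * r powi (- 3 * N)) N
     (op_product
       (op_exp (op_series q t p (x_minus_cre q t p r)))
       (op_exp (op_series q t p (x_minus_ann q t p r))))"

definition x_minus_tilde :: "complex \<Rightarrow> complex \<Rightarrow> complex \<Rightarrow> complex \<Rightarrow> symser" where
  "x_minus_tilde q t p r =
     sym_exp (pos_series (x_minus_cre q t p r)) * sym_exp (neg_series (x_minus_ann q t p r))"

definition s_plus :: "complex \<Rightarrow> complex \<Rightarrow> complex \<Rightarrow> int \<Rightarrow> sym" where
  "s_plus q t r m = smul (r powi (2 * m) / (1 - (t / q) powi m)) (alpha m)"

definition s_minus :: "complex \<Rightarrow> complex \<Rightarrow> complex \<Rightarrow> complex \<Rightarrow> int \<Rightarrow> sym" where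
  "s_minus q t p r m = smul (r powi (2 * m) / (1 - (t / q) powi m)) (alpha' q t p r m)"

definition y_mode :: "complex \<Rightarrow> complex \<Rightarrow> complex \<Rightarrow> complex \<Rightarrow> int \<Rightarrow> sym" where
  "y_mode q t p r m = smul ((1 - p powi m) / kappa q t m * r powi (- 2 * m)) (alpha' q t p r m)"

text \<open>\<open>Y(u)\<close>, \<open>\<Phi>\<^sub>\<emptyset>(u)\<close>, \<open>\<Phi>\<^sub>\<lambda>(u)\<close>, \<open>\<Phi>\<^sup>*\<^sub>\<lambda>(u)\<close> are given by their symbols; the operators are obtained by
  applying \<open>nord\<close>.\<close>

definition Y :: "complex \<Rightarrow> complex \<Rightarrow> complex \<Rightarrow> complex \<Rightarrow> symser" where
  "Y q t p r = sym_exp (two_sided (y_mode q t p r))"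

definition Phi_empty :: "complex \<Rightarrow> complex \<Rightarrow> complex \<Rightarrow> complex \<Rightarrow> symser" where
  "Phi_empty q t p r =
     sym_exp (pos_series (\<lambda>m. smul (- (1 / kappa q t (int m)) * (r\<^sup>2) ^ m) (alpha' q t p r (- int m))))
     * sym_exp (neg_series (\<lambda>m. smul (1 / kappa q t (int m) * inverse (r\<^sup>2) ^ m) (alpha' q t p r (int m))))"


subsection \<open>Partitions\<close>

definition is_partition :: "nat list \<Rightarrow> bool" where
  "is_partition l \<longleftrightarrow> sorted_wrt (\<ge>) l \<and> 0 \<notin> set l"

text \<open>Boxes \<open>(i, j)\<close> (row \<open>i\<close>, column \<open>j\<close>) are numbered from \<open>1\<close>.\<close>

definition boxes :: "nat list \<Rightarrow> (nat \<times> nat) set" where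
  "boxes l = {(i, j). 1 \<le> i \<and> i \<le> length l \<and> 1 \<le> j \<and> j \<le> l ! (i - 1)}"

definition addable :: "nat list \<Rightarrow> (nat \<times> nat) set" where
  "addable l = {b. b \<notin> boxes l \<and> (\<exists>l'. is_partition l' \<and> boxes l' = insert b (boxes l))}"

definition removable :: "nat list \<Rightarrow> (nat \<times> nat) set" where
  "removable l = {b. b \<in> boxes l \<and> (\<exists>l'. is_partition l' \<and> boxes l' = boxes l - {b})}"

definition qbox :: "complex \<Rightarrow> complex \<Rightarrow> nat \<times> nat \<Rightarrow> complex" where
  "qbox q t b = (case b of (i, j) \<Rightarrow> t powi (int i - 1) * q powi (- int j + 1))"

definition Phi :: "complex \<Rightarrow> complex \<Rightarrow> complex \<Rightarrow> complex \<Rightarrow> nat list \<Rightarrow> symser" where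
  "Phi q t p r l = Phi_empty q t p r *
     (\<Prod>(i, j)\<in>boxes l. sym_arg (r * q powi (int j - 1) * t powi (- int i + 1)) (x_minus_tilde q t p r))"

definition Phi_dual :: "complex \<Rightarrow> complex \<Rightarrow> complex \<Rightarrow> complex \<Rightarrow> nat list \<Rightarrow> symser" where
  "Phi_dual q t p r l = sym_inv (sym_arg (inverse p) (Phi q t p r l))"

end

theory Submission
  imports Defs
begin

text \<open>
  Inside a normal ordered product the modes commute, so a vertex operator is the exponential of a
  linear combination of modes, and multiplying such exponentials adds the coefficients. The
  coefficient of \<open>\<alpha>'\<^sub>m u\<^sup>-\<^sup>m\<close> in the exponent of \<open>\<Phi>\<^sub>\<lambda>(u)\<close> is
  \<open>(t/q)\<^sup>-\<^sup>m\<^sup>/\<^sup>2 (1/\<kappa>\<^sub>m + (1 - (q/t)\<^sup>m)\<^sup>-\<^sup>1 \<Sum>\<^bsub>\<box>\<in>\<lambda>\<^esub> (q\<^sup>\<box>)\<^sup>m)\<close>. Passing to \<open>\<Phi>\<^sup>*\<^sub>\<lambda>(u) \<Phi>\<^sub>\<lambda>(u)\<close> multiplies it by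
  \<open>1 - p\<^sup>m\<close>, and the corner identity
  \<open>\<Sum>\<^bsub>A(\<lambda>)\<^esub> x\<^sup>i\<^sup>-\<^sup>1y\<^sup>j\<^sup>-\<^sup>1 - xy \<Sum>\<^bsub>R(\<lambda>)\<^esub> x\<^sup>i\<^sup>-\<^sup>1y\<^sup>j\<^sup>-\<^sup>1 = 1 - (1-x)(1-y) \<Sum>\<^bsub>\<lambda>\<^esub> x\<^sup>i\<^sup>-\<^sup>1y\<^sup>j\<^sup>-\<^sup>1\<close>
  at \<open>x = t\<^sup>m\<close>, \<open>y = q\<^sup>-\<^sup>m\<close> turns it into a sum over the corners. The currents are handled in the same way,
  as normal ordering is multiplicative on symbols in modes of one sign, and on products of
  creation modes with annihilation modes.
\<close>

section \<open>Scalar multiplication on the polynomial algebras\<close>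

lemma smul_add_right: "smul c (v + w) = smul c v + smul c w"
  by (rule poly_mapping_eqI) (simp add: lookup_add ring_distribs)

lemma smul_add_left: "smul (c + d) v = smul c v + smul d v"
  by (rule poly_mapping_eqI) (simp add: lookup_add ring_distribs)

lemma smul_minus_right: "smul c (- v) = - smul c v"
  by (rule poly_mapping_eqI) simp

lemma smul_minus_left: "smul (- c) v = - smul c v"
  by (rule poly_mapping_eqI) simp

lemma smul_smul [simp]: "smul c (smul d v) = smul (c * d) v"
  by (rule poly_mapping_eqI) (simp add: mult.assoc)

lemma smul_zero_right [simp]: "smul c 0 = 0"
  by (rule poly_mapping_eqI) simp

lemma smul_zero_left [simp]: "smul 0 v = 0"
  by (rule poly_mapping_eqI) simp

lemma smul_one [simp]: "smul 1 v = v"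
  by (rule poly_mapping_eqI) simp

lemma smul_sum_right: "smul c (sum f I) = (\<Sum>i\<in>I. smul c (f i))"
  by (induction I rule: infinite_finite_induct) (simp_all add: smul_add_right)

lemma smul_sum_left: "smul (sum f I) v = (\<Sum>i\<in>I. smul (f i) v)"
  by (induction I rule: infinite_finite_induct) (simp_all add: smul_add_left)

text \<open>Turns a scalar into a constant of the algebra, so that associativity and commutativity
  of the ring move it through products.\<close>

lemma smul_conv_mult:
  fixes v :: "'a::comm_monoid_add \<Rightarrow>\<^sub>0 complex"
  shows "smul c v = Poly_Mapping.single 0 c * v"
  unfolding smul_def by (rule mult_map_scale_conv_mult)

lemma mult_smul_left:
  fixes v w :: "'a::comm_monoid_add \<Rightarrow>\<^sub>0 complex"
  shows "smul c v * w = smul c (v * w)"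
  by (simp add: smul_conv_mult mult.assoc)

lemma mult_smul_right:
  fixes v w :: "'a::comm_monoid_add \<Rightarrow>\<^sub>0 complex"
  shows "v * smul c w = smul c (v * w)"
  by (simp add: smul_conv_mult mult.left_commute)

section \<open>Normal ordering\<close>

lemma fock_deriv_add: "fock_deriv k (v + w) = fock_deriv k v + fock_deriv k w"
  by (rule poly_mapping_eqI) (simp add: lookup_fock_deriv lookup_add ring_distribs)

lemma fock_deriv_smul: "fock_deriv k (smul c v) = smul c (fock_deriv k v)"
  by (rule poly_mapping_eqI) (simp add: lookup_fock_deriv)

lemma alpha_op_add: "alpha_op q t p m (v + w) = alpha_op q t p m v + alpha_op q t p m w"
  by (simp add: alpha_op_def fock_deriv_add smul_add_right ring_distribs)

lemma alpha_op_smul: "alpha_op q t p m (smul c v) = smul c (alpha_op q t p m v)"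
  by (simp add: alpha_op_def fock_deriv_smul mult_smul_right mult.commute[where 'a = complex])

lemma alpha_op_commute:
  assumes "m < 0 \<and> n < 0 \<or> m > 0 \<and> n > 0"
  shows "alpha_op q t p m (alpha_op q t p n v) = alpha_op q t p n (alpha_op q t p m v)"
proof -
  have "fock_deriv i (fock_deriv j v) = fock_deriv j (fock_deriv i v)" for i j
    by (rule poly_mapping_eqI) (simp add: lookup_fock_deriv add_mset_commute)
  then have "smul c (fock_deriv i (smul d (fock_deriv j v))) =
      smul d (fock_deriv j (smul c (fock_deriv i v)))" for c d i j
    by (simp add: fock_deriv_smul mult.commute)
  with assms show ?thesis by (auto simp: alpha_op_def mult.left_commute)
qed

abbreviation mode_op :: "complex \<Rightarrow> complex \<Rightarrow> complex \<Rightarrow> int multiset \<Rightarrow> fock \<Rightarrow> fock" where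
  "mode_op q t p M \<equiv> foldr (alpha_op q t p) (sorted_list_of_multiset M)"

lemma foldr_alpha_op_add:
  "foldr (alpha_op q t p) ms (v + w) = foldr (alpha_op q t p) ms v + foldr (alpha_op q t p) ms w"
  by (induction ms) (simp_all add: alpha_op_add)

lemma foldr_alpha_op_smul:
  "foldr (alpha_op q t p) ms (smul c v) = smul c (foldr (alpha_op q t p) ms v)"
  by (induction ms) (simp_all add: alpha_op_smul)

lemma foldr_alpha_op_zero: "foldr (alpha_op q t p) ms 0 = 0"
  using foldr_alpha_op_smul[of q t p ms 0 0] by simp

lemma foldr_alpha_op_sum:
  "foldr (alpha_op q t p) ms (sum f I) = (\<Sum>i\<in>I. foldr (alpha_op q t p) ms (f i))"
  by (induction I rule: infinite_finite_induct)
     (simp_all add: foldr_alpha_op_add foldr_alpha_op_zero)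

text \<open>Allows the expansions of several polynomials to run over one common finite set of
  monomials, which gives linearity of normal ordering.\<close>

lemma normal_ordered_superset:
  assumes "finite K" "Poly_Mapping.keys P \<subseteq> K"
  shows "normal_ordered q t p P v = (\<Sum>M\<in>K. smul (Poly_Mapping.lookup P M) (mode_op q t p M v))"
  unfolding normal_ordered_def
  by (rule sum.mono_neutral_left) (use assms in \<open>auto simp: in_keys_iff\<close>)

lemma normal_ordered_zero [simp]: "normal_ordered q t p 0 v = 0"
  by (simp add: normal_ordered_def)

lemma normal_ordered_add:
  "normal_ordered q t p (P + Q) v = normal_ordered q t p P v + normal_ordered q t p Q v"
proof -
  have "finite (Poly_Mapping.keys P \<union> Poly_Mapping.keys Q)" by simp
  note * = normal_ordered_superset[OF this]
  show ?thesis
    using Poly_Mapping.keys_add[of P Q]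
    by (simp add: * lookup_add smul_add_left sum.distrib)
qed

lemma normal_ordered_smul: "normal_ordered q t p (smul c P) v = smul c (normal_ordered q t p P v)"
proof -
  have "Poly_Mapping.keys (smul c P) \<subseteq> Poly_Mapping.keys P" by (auto simp: in_keys_iff)
  then show ?thesis
    by (simp add: normal_ordered_superset[of "Poly_Mapping.keys P"] smul_sum_right)
qed

lemma normal_ordered_sum:
  "normal_ordered q t p (sum f I) v = (\<Sum>i\<in>I. normal_ordered q t p (f i) v)"
  by (induction I rule: infinite_finite_induct) (simp_all add: normal_ordered_add)

lemma normal_ordered_single:
  "normal_ordered q t p (Poly_Mapping.single M c) v = smul c (mode_op q t p M v)"
  by (cases "c = 0") (simp_all add: normal_ordered_def)

lemma normal_ordered_one: "normal_ordered q t p 1 v = v"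
  using normal_ordered_single[of q t p "{#}" 1 v] by (simp flip: zero_multiset_def)

lemma poly_mapping_sum_single:
  "P = (\<Sum>M\<in>Poly_Mapping.keys P. Poly_Mapping.single M (Poly_Mapping.lookup P M))"
  by (rule poly_mapping_eqI) (simp add: lookup_sum lookup_single when_def sum.delta in_keys_iff)

text \<open>Sorting may interchange modes of opposite sign, so multiplicativity fails in general. By
  bilinearity it suffices to have it for the pairs of monomials that actually occur.\<close>

lemma normal_ordered_mult:
  assumes "\<And>M M' v. M \<in> Poly_Mapping.keys P \<Longrightarrow> M' \<in> Poly_Mapping.keys Q \<Longrightarrow>
    mode_op q t p (M + M') v = mode_op q t p M (mode_op q t p M' v)"
  shows "normal_ordered q t p (P * Q) v = normal_ordered q t p P (normal_ordered q t p Q v)"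
proof -
  have "P * Q = (\<Sum>M\<in>Poly_Mapping.keys P. Poly_Mapping.single M (Poly_Mapping.lookup P M)) *
      (\<Sum>M'\<in>Poly_Mapping.keys Q. Poly_Mapping.single M' (Poly_Mapping.lookup Q M'))"
    by (simp only: poly_mapping_sum_single[symmetric])
  also have "\<dots> = (\<Sum>M\<in>Poly_Mapping.keys P. \<Sum>M'\<in>Poly_Mapping.keys Q.
      Poly_Mapping.single (M + M') (Poly_Mapping.lookup P M * Poly_Mapping.lookup Q M'))"
    by (simp add: sum_product mult_single)
  finally have "normal_ordered q t p (P * Q) v =
      (\<Sum>M\<in>Poly_Mapping.keys P. \<Sum>M'\<in>Poly_Mapping.keys Q.
        smul (Poly_Mapping.lookup P M * Poly_Mapping.lookup Q M') (mode_op q t p (M + M') v))"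
    by (simp add: normal_ordered_sum normal_ordered_single)
  also have "\<dots> = normal_ordered q t p P (normal_ordered q t p Q v)"
    by (simp add: normal_ordered_def foldr_alpha_op_sum foldr_alpha_op_smul smul_sum_right assms)
  finally show ?thesis .
qed

section \<open>Symbols in modes of one sign\<close>

definition modes_in :: "int set \<Rightarrow> sym \<Rightarrow> bool" where
  "modes_in S P \<longleftrightarrow> (\<forall>M\<in>Poly_Mapping.keys P. set_mset M \<subseteq> S)"

lemma modes_in_zero [simp]: "modes_in S 0"
  by (simp add: modes_in_def)

lemma modes_in_one [simp]: "modes_in S 1"
  by (simp add: modes_in_def)

lemma modes_in_add: "modes_in S P \<Longrightarrow> modes_in S Q \<Longrightarrow> modes_in S (P + Q)"
  using Poly_Mapping.keys_add[of P Q] unfolding modes_in_def by blast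

lemma modes_in_sum: "(\<And>i. i \<in> I \<Longrightarrow> modes_in S (f i)) \<Longrightarrow> modes_in S (sum f I)"
  by (induction I rule: infinite_finite_induct) (simp_all add: modes_in_add)

lemma modes_in_mult: "modes_in S P \<Longrightarrow> modes_in S Q \<Longrightarrow> modes_in S (P * Q)"
  using keys_mult[of P Q] unfolding modes_in_def by fastforce

lemma modes_in_smul: "modes_in S P \<Longrightarrow> modes_in S (smul c P)"
  by (auto simp: modes_in_def in_keys_iff)

lemma modes_in_alpha: "m \<in> S \<Longrightarrow> modes_in S (alpha m)"
  by (simp add: modes_in_def alpha_def)

lemma mode_op_add_same_sign:
  assumes "S = {..<0} \<or> S = {0<..}" "set_mset M \<subseteq> S" "set_mset M' \<subseteq> S"
  shows "mode_op q t p (M + M') v = mode_op q t p M (mode_op q t p M' v)"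
proof -
  let ?f = "alpha_op q t p" and ?s = sorted_list_of_multiset
  \<comment> \<open>Both lists are permutations of each other; as the operators commute pairwise,
    the composition depends on the multiset only.\<close>
  have "fold ?f (rev (?s (M + M'))) = fold ?f (rev (?s M @ ?s M'))"
  proof (rule fold_multiset_equiv)
    fix m n assume "m \<in> set (rev (?s (M + M')))" "n \<in> set (rev (?s (M + M')))"
    with assms have "m < 0 \<and> n < 0 \<or> m > 0 \<and> n > 0" by auto
    then show "?f m \<circ> ?f n = ?f n \<circ> ?f m" by (auto simp: fun_eq_iff intro: alpha_op_commute)
  qed simp
  then show ?thesis by (simp add: foldr_conv_fold)
qed

lemma mode_op_add_opposite_sign:
  assumes "set_mset M \<subseteq> {..<0}" "set_mset M' \<subseteq> {0<..}"
  shows "mode_op q t p (M + M') v = mode_op q t p M (mode_op q t p M' v)"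
proof -
  let ?s = sorted_list_of_multiset
  \<comment> \<open>Creation indices are smaller than annihilation indices, so the concatenation is
    already the sorted list and no operators are interchanged.\<close>
  have "sorted (?s M @ ?s M')"
    using assms by (fastforce simp: sorted_append)
  then have "?s M @ ?s M' = ?s (mset (?s M @ ?s M'))"
    by (simp only: sorted_list_of_multiset_mset sorted_sort_id)
  then have "?s (M + M') = ?s M @ ?s M'" by simp
  then show ?thesis by simp
qed

lemma normal_ordered_mult_same_sign:
  assumes "S = {..<0} \<or> S = {0<..}" "modes_in S P" "modes_in S Q"
  shows "normal_ordered q t p (P * Q) v = normal_ordered q t p P (normal_ordered q t p Q v)"
  using assms
  by (intro normal_ordered_mult mode_op_add_same_sign[of S]) (auto simp: modes_in_def)

lemma normal_ordered_mult_opposite_sign: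
  assumes "modes_in {..<0} P" "modes_in {0<..} Q"
  shows "normal_ordered q t p (P * Q) v = normal_ordered q t p P (normal_ordered q t p Q v)"
  using assms
  by (intro normal_ordered_mult mode_op_add_opposite_sign) (auto simp: modes_in_def)

section \<open>Exponentials of symbols\<close>

lemma coef_eqI: "(\<And>a b. coef F a b = coef G a b) \<Longrightarrow> F = G"
  by (simp add: coef_def fps_eq_iff)

lemma coef_zero [simp]: "coef 0 a b = 0"
  by (simp add: coef_def)

lemma coef_one: "coef 1 a b = (if a = 0 \<and> b = 0 then 1 else 0)"
  by (simp add: coef_def)

lemma coef_add [simp]: "coef (F + G) a b = coef F a b + coef G a b"
  by (simp add: coef_def)

lemma coef_minus [simp]: "coef (- F) a b = - coef F a b"
  by (simp add: coef_def)

lemma coef_sum: "coef (sum f I) a b = (\<Sum>i\<in>I. coef (f i) a b)"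
  by (simp add: coef_def fps_sum_nth)

lemma coef_mult: "coef (F * G) a b = (\<Sum>i\<le>a. \<Sum>j\<le>b. coef F i j * coef G (a - i) (b - j))"
  by (simp add: coef_def fps_mult_nth fps_sum_nth atLeast0AtMost)

lemma coef_of_nat_mult: "coef (of_nat n * F) a b = smul (of_nat n) (coef F a b)"
  by (induction n) (simp_all add: ring_distribs smul_add_left)

lemma coef_sym_arg: "coef (sym_arg c F) a b = smul (c ^ a * inverse c ^ b) (coef F a b)"
  by (simp add: coef_def sym_arg_def)

lemma coef_sym_exp: "coef (sym_exp A) a b = (\<Sum>k\<le>a + b. smul (1 / fact k) (coef (A ^ k) a b))"
  by (simp add: coef_def sym_exp_def)

lemma coef_two_sided:
  "coef (two_sided f) a b =
     (if b = 0 \<and> a \<noteq> 0 then f (- int a) else if a = 0 \<and> b \<noteq> 0 then f (int b) else 0)"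
  by (simp add: coef_def two_sided_def pos_series_def neg_series_def)

text \<open>The filtration by total degree in \<open>u\<close> and \<open>w\<close>; it makes the
  exponential series finite in each coefficient.\<close>

definition order_ge :: "nat \<Rightarrow> symser \<Rightarrow> bool" where
  "order_ge k F \<longleftrightarrow> (\<forall>a b. a + b < k \<longrightarrow> coef F a b = 0)"

lemma order_ge_mult:
  assumes "order_ge k F" "order_ge l G"
  shows "order_ge (k + l) (F * G)"
  unfolding order_ge_def
proof (intro allI impI)
  fix a b assume ab: "a + b < k + l"
  have "coef F i j * coef G (a - i) (b - j) = 0" if "i \<le> a" "j \<le> b" for i j
  proof -
    have "i + j < k \<or> a - i + (b - j) < l" using ab that by linarith
    then show ?thesis using assms by (auto simp: order_ge_def)
  qed
  then show "coef (F * G) a b = 0" by (simp add: coef_mult)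
qed

lemma order_ge_power: "coef A 0 0 = 0 \<Longrightarrow> order_ge k (A ^ k)"
proof (induction k)
  case (Suc k)
  then have "order_ge 1 A" by (simp add: order_ge_def)
  from order_ge_mult[OF this Suc.IH[OF Suc.prems]] show ?case by simp
qed (simp add: order_ge_def)

text \<open>The summation bound in \<open>sym_exp\<close> depends on the coefficient. Higher powers
  have too large an order to contribute, so a uniform bound works for all coefficients up to a given
  degree.\<close>

lemma coef_sym_exp_extend:
  assumes "coef A 0 0 = 0" "a + b \<le> n"
  shows "coef (sym_exp A) a b = (\<Sum>k\<le>n. smul (1 / fact k) (coef (A ^ k) a b))"
  unfolding coef_sym_exp
  by (rule sum.mono_neutral_left)
     (use assms order_ge_power[OF assms(1)] in \<open>auto simp: order_ge_def not_le\<close>)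

text \<open>The usual proof by the binomial theorem, applied to truncations at the total degree
  \<open>n\<close> of the coefficient under consideration.\<close>

lemma sym_exp_add:
  assumes A: "coef A 0 0 = 0" and B: "coef B 0 0 = 0"
  shows "sym_exp (A + B) = sym_exp A * sym_exp B"
proof (rule coef_eqI)
  fix a b :: nat
  define n where "n = a + b"
  define g where "g k l = smul (1 / (fact k * fact l)) (coef (A ^ k * B ^ l) a b)" for k l
  \<comment> \<open>Scalars as constant series: the truncated exponentials \<open>T\<close> become
    ring expressions, and their product can be expanded by distributivity.\<close>
  define C :: "complex \<Rightarrow> symser" where "C c = fps_const (fps_const (Poly_Mapping.single 0 c))" for c
  define T where "T X = (\<Sum>k\<le>n. C (1 / fact k) * X ^ k)" for X
  have C: "coef (C c * F) i j = smul c (coef F i j)" for c F i j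
    by (simp add: coef_def C_def smul_conv_mult)
  have T: "coef (sym_exp X) i j = coef (T X) i j" if "coef X 0 0 = 0" "i + j \<le> n" for X i j
    using coef_sym_exp_extend[OF that] by (simp add: T_def coef_sum C)
  have "coef (sym_exp A * sym_exp B) a b = coef (T A * T B) a b"
    unfolding coef_mult
    by (intro sum.cong refl arg_cong2[of _ _ _ _ "(*)"] T A B) (auto simp: n_def)
  also have "T A * T B = (\<Sum>k\<le>n. \<Sum>l\<le>n. C (1 / fact k) * (C (1 / fact l) * (A ^ k * B ^ l)))"
    by (simp add: T_def sum_product mult_ac)
  also have "coef \<dots> a b = (\<Sum>k\<le>n. \<Sum>l\<le>n. g k l)"
    by (simp add: coef_sum C g_def)
  also have "\<dots> = (\<Sum>(k, l)\<in>{..n} \<times> {..n}. g k l)"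
    by (simp add: sum.cartesian_product)
  \<comment> \<open>The part of the square outside the triangle vanishes, since
    \<open>A ^ k * B ^ l\<close> has order at least \<open>k + l\<close>.\<close>
  also have "\<dots> = (\<Sum>(k, l)\<in>{(k, l). k + l \<le> n}. g k l)"
  proof (rule sum.mono_neutral_right)
    have *: "g k l = 0" if "k + l > n" for k l
      using order_ge_mult[OF order_ge_power[OF A] order_ge_power[OF B], of k l] that
      by (simp add: g_def order_ge_def n_def)
    show "\<forall>x\<in>{..n} \<times> {..n} - {(k, l). k + l \<le> n}. (case x of (k, l) \<Rightarrow> g k l) = 0"
    proof
      fix x assume "x \<in> {..n} \<times> {..n} - {(k, l). k + l \<le> n}"
      then show "(case x of (k, l) \<Rightarrow> g k l) = 0" by (cases x) (simp add: *)
    qed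
  qed auto
  also have "\<dots> = (\<Sum>m\<le>n. \<Sum>k\<le>m. g k (m - k))"
    by (rule sum.triangle_reindex_eq)
  also have "\<dots> = (\<Sum>m\<le>n. smul (1 / fact m) (coef ((A + B) ^ m) a b))"
  proof (rule sum.cong[OF refl])
    fix m
    have "smul (1 / fact m) (coef ((A + B) ^ m) a b) =
        (\<Sum>k\<le>m. smul (1 / fact m * of_nat (m choose k)) (coef (A ^ k * B ^ (m - k)) a b))"
      by (simp add: binomial_ring coef_sum smul_sum_right mult.assoc coef_of_nat_mult)
    also have "\<dots> = (\<Sum>k\<le>m. g k (m - k))"
      by (rule sum.cong) (simp_all add: g_def binomial_fact)
    finally show "(\<Sum>k\<le>m. g k (m - k)) = smul (1 / fact m) (coef ((A + B) ^ m) a b)" ..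
  qed
  also have "\<dots> = coef (sym_exp (A + B)) a b"
    by (simp add: coef_sym_exp n_def)
  finally show "coef (sym_exp (A + B)) a b = coef (sym_exp A * sym_exp B) a b" ..
qed

lemma sym_exp_zero: "sym_exp 0 = 1"
proof (rule coef_eqI)
  fix a b :: nat
  have "coef (sym_exp 0) a b = (\<Sum>k\<le>a + b. if k = 0 then coef 1 a b else 0)"
    unfolding coef_sym_exp by (rule sum.cong) (auto simp: power_0_left)
  then show "coef (sym_exp 0) a b = coef 1 a b" by (simp add: sum.delta)
qed

lemma sym_exp_sum:
  assumes "\<And>i. i \<in> I \<Longrightarrow> coef (A i) 0 0 = 0"
  shows "sym_exp (\<Sum>i\<in>I. A i) = (\<Prod>i\<in>I. sym_exp (A i))"
  using assms
  by (induction I rule: infinite_finite_induct) (simp_all add: sym_exp_zero sym_exp_add coef_sum)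

lemma sym_inv_sym_exp:
  assumes "coef A 0 0 = 0"
  shows "sym_inv (sym_exp A) = sym_exp (- A)"
  using sym_exp_add[of A "- A"] assms by (intro sym_inv_eq) (simp add: sym_exp_zero)

text \<open>The weight \<open>c^(a-b)\<close> depends on the bidegree only and is multiplicative in
  it, so the substitution is a ring homomorphism.\<close>

lemma sym_arg_mult: "sym_arg c (F * G) = sym_arg c F * sym_arg c G"
proof (rule coef_eqI)
  fix a b :: nat
  have "c ^ a * inverse c ^ b = (c ^ i * inverse c ^ j) * (c ^ (a - i) * inverse c ^ (b - j))"
    if "i \<le> a" "j \<le> b" for i j
    using that by (simp add: mult.commute mult.left_commute flip: power_add)
  then show "coef (sym_arg c (F * G)) a b = coef (sym_arg c F * sym_arg c G) a b"
    by (simp add: coef_sym_arg coef_mult smul_sum_right mult_smul_left mult_smul_right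
        mult.commute[where 'a = complex])
qed

lemma sym_arg_one: "sym_arg c 1 = 1"
  by (rule coef_eqI) (simp add: coef_sym_arg coef_one)

lemma sym_arg_power: "sym_arg c (F ^ k) = sym_arg c F ^ k"
  by (induction k) (simp_all add: sym_arg_mult sym_arg_one)

lemma sym_arg_sym_exp: "sym_arg c (sym_exp A) = sym_exp (sym_arg c A)"
  by (rule coef_eqI)
     (simp add: coef_sym_arg coef_sym_exp smul_sum_right mult.commute[where 'a = complex]
       flip: sym_arg_power)

lemma two_sided_cong: "(\<And>m. m \<noteq> 0 \<Longrightarrow> f m = g m) \<Longrightarrow> two_sided f = two_sided g"
  by (rule coef_eqI) (simp add: coef_two_sided)

lemma two_sided_add: "two_sided f + two_sided g = two_sided (\<lambda>m. f m + g m)"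
  by (rule coef_eqI) (simp add: coef_two_sided)

lemma two_sided_minus: "- two_sided f = two_sided (\<lambda>m. - f m)"
  by (rule coef_eqI) (simp add: coef_two_sided)

lemma two_sided_sum: "(\<Sum>i\<in>I. two_sided (f i)) = two_sided (\<lambda>m. \<Sum>i\<in>I. f i m)"
  by (rule coef_eqI) (simp add: coef_sum coef_two_sided)

lemma sym_arg_two_sided: "sym_arg c (two_sided f) = two_sided (\<lambda>m. smul (c powi (- m)) (f m))"
  by (rule coef_eqI) (simp add: coef_sym_arg coef_two_sided power_int_minus power_inverse)

lemma coef_two_sided_0_0 [simp]: "coef (two_sided f) 0 0 = 0"
  by (simp add: coef_two_sided)

text \<open>Symbols commute, so the two exponents add up. The value of the merged family at 0 is a
  dummy, as \<open>two_sided\<close> skips it.\<close>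

lemma sym_exp_pos_mult_neg:
  "sym_exp (pos_series f) * sym_exp (neg_series g) =
     sym_exp (two_sided (\<lambda>m. if m < 0 then f (nat (- m)) else g (nat m)))"
proof -
  have "coef (pos_series f) 0 0 = 0" "coef (neg_series g) 0 0 = 0"
    by (simp_all add: coef_def pos_series_def neg_series_def)
  then have "sym_exp (pos_series f) * sym_exp (neg_series g) =
      sym_exp (pos_series f + neg_series g)" by (simp add: sym_exp_add)
  also have "pos_series f + neg_series g =
      two_sided (\<lambda>m. if m < 0 then f (nat (- m)) else g (nat m))"
    by (rule coef_eqI)
       (simp add: coef_def two_sided_def pos_series_def neg_series_def)
  finally show ?thesis .
qed

section \<open>Exponentials of operators\<close>

text \<open>The common one-variable form of \<open>pos_series\<close> and \<open>neg_series\<close>,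
  used to compute powers of both at once.\<close>

definition mode_series :: "(nat \<Rightarrow> sym) \<Rightarrow> sym fps" where
  "mode_series f = Abs_fps (\<lambda>n. if n = 0 then 0 else f n)"

lemma coef_pos_series_power:
  "coef (pos_series f ^ k) a b = (if b = 0 then fps_nth (mode_series f ^ k) a else 0)"
proof -
  have "fps_nth (pos_series f ^ k) a = fps_const (fps_nth (mode_series f ^ k) a)"
  proof (induction k arbitrary: a)
    case (Suc k)
    have "fps_nth (pos_series f) i = fps_const (fps_nth (mode_series f) i)" for i
      by (simp add: pos_series_def mode_series_def)
    moreover have "(\<Sum>i\<in>I. fps_const (h i)) = fps_const (\<Sum>i\<in>I. h i :: sym)" for h and I :: "nat set"
      by (induction I rule: infinite_finite_induct) simp_all
    ultimately show ?case
      by (simp add: fps_mult_nth[of _ _ a] Suc)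
  qed simp
  then show ?thesis by (simp add: coef_def)
qed

lemma coef_neg_series_power:
  "coef (neg_series f ^ k) a b = (if a = 0 then fps_nth (mode_series f ^ k) b else 0)"
  by (simp add: coef_def neg_series_def mode_series_def fps_const_power)

lemma modes_in_mode_series_power:
  assumes "\<And>n. n > 0 \<Longrightarrow> modes_in S (f n)"
  shows "modes_in S (fps_nth (mode_series f ^ k) n)"
proof (induction k arbitrary: n)
  case (Suc k)
  then show ?case
    using assms by (auto simp: fps_mult_nth mode_series_def intro!: modes_in_sum modes_in_mult)
qed simp

text \<open>Powers of operators and powers of symbols satisfy the same recursion, because normal
  ordering is multiplicative on modes of one sign.\<close>

lemma op_power_op_series:
  assumes S: "S = {..<0} \<or> S = {0<..}" and f: "\<And>n. n > 0 \<Longrightarrow> modes_in S (f n)"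
  shows "op_power (op_series q t p f) k n v = normal_ordered q t p (fps_nth (mode_series f ^ k) n) v"
proof (induction k arbitrary: n)
  case 0
  then show ?case by (simp add: normal_ordered_one)
next
  case (Suc k)
  have "op_power (op_series q t p f) (Suc k) n v =
      (\<Sum>i\<le>n. normal_ordered q t p (fps_nth (mode_series f) i)
        (normal_ordered q t p (fps_nth (mode_series f ^ k) (n - i)) v))"
    by (auto simp: Suc op_series_def mode_series_def intro!: sum.cong)
  moreover have "modes_in S (fps_nth (mode_series f) i)" for i
    using f by (simp add: mode_series_def)
  ultimately show ?case
    using S modes_in_mode_series_power[of S f, OF f]
    by (simp add: fps_mult_nth normal_ordered_sum normal_ordered_mult_same_sign atLeast0AtMost)
qed

lemma op_exp_op_series:
  assumes S: "S = {..<0} \<or> S = {0<..}" and f: "\<And>n. n > 0 \<Longrightarrow> modes_in S (f n)"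
  shows "op_exp (op_series q t p f) n v =
    normal_ordered q t p (\<Sum>k\<le>n. smul (1 / fact k) (fps_nth (mode_series f ^ k) n)) v"
  by (simp add: op_exp_def op_power_op_series[OF S f] normal_ordered_sum normal_ordered_smul)

text \<open>Connects the operator definition of a current with its symbol. The first exponential
  involves \<open>u\<close> alone and the second \<open>w\<close> alone, so each coefficient of the
  product is a single product of a creation part and an annihilation part.\<close>

lemma op_product_op_exp:
  assumes f: "\<And>n. n > 0 \<Longrightarrow> modes_in {..<0} (f n)"
    and g: "\<And>n. n > 0 \<Longrightarrow> modes_in {0<..} (g n)"
  shows "op_product (op_exp (op_series q t p f)) (op_exp (op_series q t p g)) =
    nord q t p (sym_exp (pos_series f) * sym_exp (neg_series g))"
proof -
  define E where "E h n = (\<Sum>k\<le>n. smul (1 / fact k) (fps_nth (mode_series h ^ k) n))" for h n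
  have pos: "coef (sym_exp (pos_series f)) a b = (if b = 0 then E f a else 0)" for a b
    by (simp add: coef_sym_exp coef_pos_series_power E_def)
  have neg: "coef (sym_exp (neg_series g)) a b = (if a = 0 then E g b else 0)" for a b
    by (simp add: coef_sym_exp coef_neg_series_power E_def)
  have coef: "coef (sym_exp (pos_series f) * sym_exp (neg_series g)) a b = E f a * E g b" for a b
  proof -
    have "coef (sym_exp (pos_series f) * sym_exp (neg_series g)) a b =
        (\<Sum>i\<le>a. \<Sum>j\<le>b. if j = 0 then if i = a then E f a * E g b else 0 else 0)"
      unfolding coef_mult by (intro sum.cong refl) (auto simp: pos neg)
    then show ?thesis by (simp add: sum.delta)
  qed
  have "modes_in {..<0} (E f n)" "modes_in {0<..} (E g n)" for n
    unfolding E_def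
    by (auto intro!: modes_in_sum modes_in_smul modes_in_mode_series_power f g)
  then have "normal_ordered q t p (E f a * E g b) v =
      op_exp (op_series q t p f) a (op_exp (op_series q t p g) b v)" for a b v
    by (simp add: normal_ordered_mult_opposite_sign E_def
        op_exp_op_series[of "{..<0}", OF _ f] op_exp_op_series[of "{0<..}", OF _ g])
  then show ?thesis
    by (simp add: fun_eq_iff op_product_def nord_def coef cong: if_cong)
qed

section \<open>Rescaling the argument of a distribution\<close>

lemma smul_eq_0_iff: "smul c v = 0 \<longleftrightarrow> c = 0 \<or> v = 0"
  by (auto simp: poly_mapping_eq_iff fun_eq_iff)

text \<open>No summability is needed: \<open>c \<noteq> 0\<close> preserves the support, and \<open>Sum_any\<close> is \<open>0\<close> on infinite supports.\<close>

lemma smul_Sum_any: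
  assumes "c \<noteq> 0"
  shows "smul c (Sum_any f) = Sum_any (\<lambda>i. smul c (f i))"
  using assms by (simp add: Sum_any.expand_set smul_sum_right smul_eq_0_iff)

lemma dist_arg_nord:
  assumes "c \<noteq> 0"
  shows "dist_arg c (nord q t p F) = nord q t p (sym_arg c F)"
proof (intro ext)
  fix n v
  \<comment> \<open>All terms \<open>u^a w^b\<close> contributing to mode \<open>n\<close> have
    \<open>a - b = n\<close>, hence are scaled by the same factor.\<close>
  have "c ^ nat (n + int b) * inverse c ^ b = c powi n" if "n + int b \<ge> 0" for b
  proof -
    have "c powi (n + int b) = c powi n * c ^ b"
      using assms by (simp add: power_int_add)
    moreover have "c powi (n + int b) = c ^ nat (n + int b)"
      using that by (simp add: power_int_def)
    ultimately show ?thesis using assms by (simp add: power_inverse)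
  qed
  then show "dist_arg c (nord q t p F) n v = nord q t p (sym_arg c F) n v"
    using assms
    by (auto simp: dist_arg_def nord_def smul_Sum_any coef_sym_arg normal_ordered_smul
        intro!: Sum_any.cong)
qed

lemma dist_arg_dist_monom:
  assumes "c \<noteq> 0"
  shows "dist_arg c (dist_monom d k V) = dist_monom (d * c powi k) k (dist_arg c V)"
proof (intro ext)
  fix n v
  have "c powi n = c powi k * c powi (n - k)" using assms by (simp flip: power_int_add)
  then show "dist_arg c (dist_monom d k V) n v = dist_monom (d * c powi k) k (dist_arg c V) n v"
    by (simp add: dist_arg_def dist_monom_def mult_ac)
qed

section \<open>Corners of partitions\<close>

text \<open>Rows are counted from 0 and continued by empty rows, so that a partition becomes a
  weakly decreasing function on all naturals.\<close>

definition row :: "nat list \<Rightarrow> nat \<Rightarrow> nat" where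
  "row l i = (if i < length l then l ! i else 0)"

lemma mem_boxes: "(i, j) \<in> boxes l \<longleftrightarrow> 1 \<le> i \<and> 1 \<le> j \<and> j \<le> row l (i - 1)"
  by (auto simp: boxes_def row_def split: if_splits)

lemma boxes_eq_image: "boxes l = (\<lambda>(i, c). (Suc i, Suc c)) ` (SIGMA i:{..<length l}. {..<row l i})"
proof (rule set_eqI)
  fix b
  show "b \<in> boxes l \<longleftrightarrow> b \<in> (\<lambda>(i, c). (Suc i, Suc c)) ` (SIGMA i:{..<length l}. {..<row l i})"
  proof (cases b)
    case (Pair i j)
    then show ?thesis
      by (cases i; cases j) (auto simp: mem_boxes image_iff row_def split: if_splits)
  qed
qed

lemma finite_boxes [simp]: "finite (boxes l)"
  by (simp add: boxes_eq_image)

lemma row_antimono: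
  assumes "is_partition l" "i \<le> j"
  shows "row l j \<le> row l i"
  using assms by (cases "i = j") (auto simp: is_partition_def row_def sorted_wrt_iff_nth_less)

lemma row_length [simp]: "row l (length l) = 0"
  by (simp add: row_def)

lemma partition_of_rows:
  assumes g: "\<And>i j. i \<le> j \<Longrightarrow> g j \<le> g i" and n: "g n = (0::nat)"
  shows "\<exists>l. is_partition l \<and> row l = g"
proof -
  \<comment> \<open>Cutting at the first zero keeps 0 out of the list, as
    \<open>is_partition\<close> demands.\<close>
  define k where "k = (LEAST n. g n = 0)"
  have k: "g k = 0" unfolding k_def using n by (rule LeastI)
  have pos: "g i \<noteq> 0" if "i < k" for i using that not_less_Least unfolding k_def by blast
  have zero: "g i = 0" if "k \<le> i" for i using g[OF that] k by simp
  have "is_partition (map g [0..<k])"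
    using g pos by (auto simp: is_partition_def sorted_wrt_iff_nth_less image_iff)
  moreover have "row (map g [0..<k]) = g"
    by (auto simp: row_def fun_eq_iff zero not_less)
  ultimately show ?thesis by blast
qed

text \<open>A new box must stand at the end of its row, below a strictly longer row. The index
  \<open>i = length l\<close> stands for opening a new row.\<close>

lemma addable_eq_image:
  assumes l: "is_partition l"
  shows "addable l = (\<lambda>i. (Suc i, Suc (row l i))) `
    {i. i \<le> length l \<and> (i = 0 \<or> row l i < row l (i - 1))}" (is "_ = ?f ` ?I")
proof (intro equalityI subsetI)
  fix b assume "b \<in> addable l"
  then obtain l' where b: "b \<notin> boxes l" and l': "is_partition l'" "boxes l' = insert b (boxes l)"
    by (auto simp: addable_def)
  obtain i j where ij: "b = (i, j)" by (cases b)
  have b': "(i, j) \<in> boxes l'" using l' ij by simp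
  then obtain i' j' where S: "i = Suc i'" "j = Suc j'"
    by (cases i; cases j) (auto simp: mem_boxes)
  have "\<not> j' < row l i'" using b ij S by (simp add: mem_boxes)
  \<comment> \<open>The left neighbour of the new box lies in \<open>l'\<close> and differs from
    \<open>b\<close>, so it was in \<open>l\<close> before.\<close>
  moreover have "j' \<le> row l i'"
  proof (cases j')
    case (Suc c)
    then have "(i, j') \<in> boxes l'" using b' S by (simp add: mem_boxes)
    then have "(i, j') \<in> boxes l" using l' ij S by auto
    then show ?thesis using S by (simp add: mem_boxes)
  qed simp
  ultimately have j': "j' = row l i'" by simp
  have row: "i' = 0 \<or> row l i' < row l (i' - 1)"
  proof (cases i')
    case (Suc c)
    \<comment> \<open>Since \<open>i = Suc i'\<close> in the numbering from 1, this is the neighbour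
      above the new box.\<close>
    then have "(i', j) \<in> boxes l'"
      using b' S row_antimono[OF l'(1), of c i'] by (simp add: mem_boxes)
    then have "(i', j) \<in> boxes l" using l' ij S by auto
    then show ?thesis using S Suc j' by (simp add: mem_boxes)
  qed simp
  then have "i' \<le> length l" by (auto simp: row_def split: if_splits)
  with row have "i' \<in> ?I" by simp
  moreover have "b = ?f i'" using ij S j' by simp
  ultimately show "b \<in> ?f ` ?I" by blast
next
  fix b assume "b \<in> ?f ` ?I"
  then obtain i where i: "i \<le> length l" "i = 0 \<or> row l i < row l (i - 1)" and b: "b = ?f i"
    by blast
  \<comment> \<open>The enlarged partition, given by its row lengths. The strict inequality with the
    row above keeps it weakly decreasing.\<close>
  define g where "g = (row l)(i := Suc (row l i))"
  have "g m \<le> g n" if "n \<le> m" for n m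
  proof (cases "m = i \<and> n < i")
    case True
    then have "row l (i - 1) \<le> row l n" by (intro row_antimono[OF l]) auto
    with True i show ?thesis by (auto simp: g_def)
  next
    case False
    with row_antimono[OF l that] that show ?thesis by (auto simp: g_def intro: le_SucI)
  qed
  \<comment> \<open>One index further than \<open>length l\<close>, because that row may be the one
    just opened.\<close>
  moreover have "g (Suc (length l)) = 0" using i by (simp add: g_def row_def)
  ultimately obtain l' where "is_partition l'" and row: "row l' = g"
    using partition_of_rows[of g] by blast
  moreover have "boxes l' = insert b (boxes l)"
    by (auto simp: mem_boxes row g_def b split: if_splits)
  moreover have "b \<notin> boxes l" by (simp add: b mem_boxes)
  ultimately show "b \<in> addable l" by (auto simp: addable_def)
qed

text \<open>Dual to the addable case: if the right or lower neighbour were present, it would survive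
  the removal and force the removed box to remain.\<close>

lemma removable_eq_image:
  assumes l: "is_partition l"
  shows "removable l = (\<lambda>i. (Suc i, row l i)) ` {i. i < length l \<and> row l (Suc i) < row l i}"
    (is "_ = ?f ` ?I")
proof (intro equalityI subsetI)
  fix b assume "b \<in> removable l"
  then obtain l' where b: "b \<in> boxes l" and l': "is_partition l'" "boxes l' = boxes l - {b}"
    by (auto simp: removable_def)
  obtain i j where ij: "b = (i, j)" by (cases b)
  from b ij obtain i' where S: "i = Suc i'" "1 \<le> j" "j \<le> row l i'"
    by (cases i) (auto simp: mem_boxes)
  have "(i, Suc j) \<notin> boxes l"
  proof
    assume "(i, Suc j) \<in> boxes l"
    then have "(i, Suc j) \<in> boxes l'" using l' ij by simp
    then have "(i, j) \<in> boxes l'" using S by (simp add: mem_boxes)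
    then show False using l' ij by simp
  qed
  then have j: "j = row l i'" using S by (simp add: mem_boxes)
  have "(Suc i, j) \<notin> boxes l"
  proof
    assume "(Suc i, j) \<in> boxes l"
    then have "(Suc i, j) \<in> boxes l'" using l' ij by simp
    then have "(i, j) \<in> boxes l'"
      using S row_antimono[OF l'(1), of i' i] by (simp add: mem_boxes)
    then show False using l' ij by simp
  qed
  then have row: "row l (Suc i') < row l i'" using S j by (simp add: mem_boxes)
  then have "i' < length l" by (auto simp: row_def split: if_splits)
  with row have "i' \<in> ?I" by simp
  moreover have "b = ?f i'" using ij S j by simp
  ultimately show "b \<in> ?f ` ?I" by blast
next
  fix b assume "b \<in> ?f ` ?I"
  then obtain i where i: "i < length l" "row l (Suc i) < row l i" and b: "b = ?f i" by blast
  define g where "g = (row l)(i := row l i - 1)"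
  have "g m \<le> g n" if "n \<le> m" for n m
  proof (cases "n = i \<and> i < m")
    case True
    then have "row l m \<le> row l (Suc i)" by (intro row_antimono[OF l]) auto
    with True i show ?thesis by (auto simp: g_def)
  next
    case False
    with row_antimono[OF l that] that show ?thesis by (auto simp: g_def)
  qed
  moreover have "g (length l) = 0" using i by (simp add: g_def)
  ultimately obtain l' where "is_partition l'" and row: "row l' = g"
    using partition_of_rows[of g] by blast
  moreover have "boxes l' = boxes l - {b}"
    using i by (auto simp: mem_boxes row g_def b split: if_splits)
  moreover have "b \<in> boxes l" using i by (simp add: b mem_boxes)
  ultimately show "b \<in> removable l" by (auto simp: removable_def)
qed

text \<open>Removes the corner conditions, leaving unrestricted sums over the rows.\<close>

lemma sum_corners:
  fixes x y :: "'a::comm_ring_1"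
  assumes g: "\<And>i. g (Suc i) \<le> g i"
  shows "(\<Sum>i | i \<le> n \<and> (i = 0 \<or> g i < g (i - 1)). x ^ i * y ^ g i)
      - x * (\<Sum>i | i < n \<and> g (Suc i) < g i. x ^ i * y ^ g i) =
    (\<Sum>i\<le>n. x ^ i * y ^ g i) - x * (\<Sum>i<n. x ^ i * y ^ g i)"
proof -
  define a where "a i = x ^ i * y ^ g i" for i
  have "(\<Sum>i\<le>n. if i = 0 \<or> g i < g (i - 1) then a i else 0)
      - x * (\<Sum>i<n. if g (Suc i) < g i then a i else 0) = (\<Sum>i\<le>n. a i) - x * (\<Sum>i<n. a i)"
  proof (induction n)
    case (Suc n)
    \<comment> \<open>row \<open>n + 1\<close> has an addable box iff row \<open>n\<close> has a removable one; else their terms cancel\<close>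
    have "a (Suc n) = x * a n" if "\<not> g (Suc n) < g n"
      using that g[of n] by (simp add: a_def)
    with Suc show ?case by (auto simp: algebra_simps)
  qed (simp add: a_def)
  then show ?thesis
    by (simp add: a_def flip: sum.inter_filter lessThan_iff atMost_iff cong: conj_cong)
qed

text \<open>Both sides equal \<open>x ^ k + (1 - x) * (\<Sum>i<k. x ^ i * y ^ row l i)\<close> with
  \<open>k = length l\<close>: the left one by \<open>sum_corners\<close>, the right one by
  geometric series.\<close>

lemma corner_identity:
  fixes x y :: "'a::comm_ring_1"
  assumes l: "is_partition l"
  shows "(\<Sum>(i, j)\<in>addable l. x ^ (i - 1) * y ^ (j - 1))
      - x * y * (\<Sum>(i, j)\<in>removable l. x ^ (i - 1) * y ^ (j - 1)) =
    1 - (1 - x) * (1 - y) * (\<Sum>(i, j)\<in>boxes l. x ^ (i - 1) * y ^ (j - 1))"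
proof -
  let ?k = "length l" and ?g = "row l"
  have A: "(\<Sum>(i, j)\<in>addable l. x ^ (i - 1) * y ^ (j - 1)) =
      (\<Sum>i | i \<le> ?k \<and> (i = 0 \<or> ?g i < ?g (i - 1)). x ^ i * y ^ ?g i)"
    unfolding addable_eq_image[OF l] by (subst sum.reindex) (auto simp: inj_on_def)
  have "(\<Sum>(i, j)\<in>removable l. x ^ (i - 1) * y ^ (j - 1)) =
      (\<Sum>i | i < ?k \<and> ?g (Suc i) < ?g i. x ^ i * y ^ (?g i - 1))"
    unfolding removable_eq_image[OF l] by (subst sum.reindex) (auto simp: inj_on_def)
  \<comment> \<open>A removable box is the last one of its row, so its column exponent is one less
    than the row length; the factor \<open>y\<close> makes up for this.\<close>
  then have "y * (\<Sum>(i, j)\<in>removable l. x ^ (i - 1) * y ^ (j - 1)) =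
      (\<Sum>i | i < ?k \<and> ?g (Suc i) < ?g i. x ^ i * (y * y ^ (?g i - 1)))"
    by (simp add: sum_distrib_left mult_ac)
  also have "\<dots> = (\<Sum>i | i < ?k \<and> ?g (Suc i) < ?g i. x ^ i * y ^ ?g i)"
    by (rule sum.cong) (auto simp flip: power_Suc)
  finally have R: "y * (\<Sum>(i, j)\<in>removable l. x ^ (i - 1) * y ^ (j - 1)) =
      (\<Sum>i | i < ?k \<and> ?g (Suc i) < ?g i. x ^ i * y ^ ?g i)" .
  have "(\<Sum>(i, j)\<in>boxes l. x ^ (i - 1) * y ^ (j - 1)) =
      (\<Sum>(i, c)\<in>(SIGMA i:{..<?k}. {..<?g i}). x ^ i * y ^ c)"
    unfolding boxes_eq_image by (subst sum.reindex) (auto simp: inj_on_def case_prod_unfold)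
  also have "\<dots> = (\<Sum>i<?k. x ^ i * (\<Sum>c<?g i. y ^ c))"
    by (simp add: sum_distrib_left flip: sum.Sigma)
  finally have "(1 - y) * (\<Sum>(i, j)\<in>boxes l. x ^ (i - 1) * y ^ (j - 1)) =
      (\<Sum>i<?k. x ^ i * ((1 - y) * (\<Sum>c<?g i. y ^ c)))"
    by (simp add: sum_distrib_left mult_ac)
  \<comment> \<open>The geometric series along each row; the one over the rows follows with the
    factor \<open>1 - x\<close>.\<close>
  also have "\<dots> = (\<Sum>i<?k. x ^ i) - (\<Sum>i<?k. x ^ i * y ^ ?g i)"
    by (simp add: sum_subtractf right_diff_distrib flip: one_diff_power_eq)
  finally have "(1 - x) * (1 - y) * (\<Sum>(i, j)\<in>boxes l. x ^ (i - 1) * y ^ (j - 1)) =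
      (1 - x) * (\<Sum>i<?k. x ^ i) - (1 - x) * (\<Sum>i<?k. x ^ i * y ^ ?g i)"
    unfolding mult.assoc[of "1 - x" "1 - y"] by (simp only: right_diff_distrib)
  also have "(1 - x) * (\<Sum>i<?k. x ^ i) = 1 - x ^ ?k"
    by (rule one_diff_power_eq [symmetric])
  finally have B: "1 - (1 - x) * (1 - y) * (\<Sum>(i, j)\<in>boxes l. x ^ (i - 1) * y ^ (j - 1)) =
      x ^ ?k + (1 - x) * (\<Sum>i<?k. x ^ i * y ^ ?g i)"
    by simp
  have "(\<Sum>(i, j)\<in>addable l. x ^ (i - 1) * y ^ (j - 1))
      - x * y * (\<Sum>(i, j)\<in>removable l. x ^ (i - 1) * y ^ (j - 1)) =
      (\<Sum>i\<le>?k. x ^ i * y ^ ?g i) - x * (\<Sum>i<?k. x ^ i * y ^ ?g i)"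
    unfolding A mult.assoc R by (rule sum_corners) (simp add: row_antimono[OF l])
  also have "\<dots> = x ^ ?k + (1 - x) * (\<Sum>i<?k. x ^ i * y ^ ?g i)"
    by (simp add: algebra_simps flip: lessThan_Suc_atMost)
  finally show ?thesis unfolding B .
qed

section \<open>Currents and vertex operators\<close>

text \<open>Replacing each factor \<open>1 - z\<close> by \<open>1 - 1/z\<close> multiplies it by
  \<open>-1/z\<close>; the product of the three arguments \<open>z\<close> is 1, so only the sign
  remains.\<close>

lemma kappa_uminus:
  assumes "q \<noteq> 0" "t \<noteq> 0"
  shows "kappa q t (- m) = - kappa q t m"
  using assms
  by (simp add: kappa_def power_int_minus power_int_divide_distrib field_simps)

lemma qbox_powi:
  assumes "i > 0" "j > 0"
  shows "qbox q t (i, j) powi n = (t powi n) ^ (i - 1) * (q powi (- n)) ^ (j - 1)"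
proof -
  have "int i - 1 = int (i - 1)" "- int j + 1 = - int (j - 1)" using assms by auto
  then have "qbox q t (i, j) = t powi int (i - 1) * q powi - int (j - 1)"
    by (simp only: qbox_def case_prod_conv)
  moreover have "(t powi int (i - 1)) powi n = (t powi n) powi int (i - 1)"
    "(q powi - int (j - 1)) powi n = (q powi (- n)) powi int (j - 1)"
    by (simp_all only: power_int_mult[symmetric] mult.commute mult_minus_left mult_minus_right)
  ultimately show ?thesis
    by (simp add: power_int_mult_distrib del: of_nat_diff)
qed

lemma powi_neq_1:
  fixes x :: complex
  assumes "\<And>m::nat. m > 0 \<Longrightarrow> x ^ m \<noteq> 1" "m \<noteq> 0"
  shows "x powi m \<noteq> 1"
proof (cases "m > 0")
  case True
  then show ?thesis using assms(1)[of "nat m"] by (simp add: power_int_def)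
next
  case False
  then show ?thesis using assms(1)[of "nat (- m)"] assms(2)
    by (simp add: power_int_def power_inverse)
qed

lemma norm_lt_1_powi_neq_1:
  fixes x :: complex
  assumes "norm x < 1" "m \<noteq> 0"
  shows "x powi m \<noteq> 1"
proof (rule powi_neq_1[OF _ assms(2)])
  fix m :: nat assume "m > 0"
  then have "norm (x ^ m) < 1" using assms(1) by (simp add: norm_power power_less_one_iff)
  then show "x ^ m \<noteq> 1" by auto
qed

locale generic_params =
  fixes q t p r :: complex
  assumes q: "q \<noteq> 0" and t: "t \<noteq> 0" and p: "p \<noteq> 0"
    and q_root: "\<And>m::nat. m > 0 \<Longrightarrow> q ^ m \<noteq> 1"
    and t_root: "\<And>m::nat. m > 0 \<Longrightarrow> t ^ m \<noteq> 1"
    and tq_root: "\<And>m::nat. m > 0 \<Longrightarrow> (t / q) ^ m \<noteq> 1"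
    and norm_p: "norm p < 1" and norm_pstar: "norm (p * q / t) < 1"
    and r: "r ^ 4 = t / q"
begin

lemma r_nonzero: "r \<noteq> 0"
  using r q t by auto

lemma powi_generic:
  assumes "m \<noteq> 0"
  shows "q powi m \<noteq> 1" "t powi m \<noteq> 1" "(t / q) powi m \<noteq> 1" "p powi m \<noteq> 1"
    "pstar q t p powi m \<noteq> 1"
  using assms powi_neq_1[OF q_root] powi_neq_1[OF t_root] powi_neq_1[OF tq_root]
    norm_lt_1_powi_neq_1[OF norm_p] norm_lt_1_powi_neq_1[OF norm_pstar]
  by (simp_all add: pstar_def)

lemma r_powi: "(r powi m) ^ 4 = t powi m / q powi m"
proof -
  have "(r powi m) ^ 4 = (r ^ 4) powi m"
    using power_int_mult[of r m 4] power_int_mult[of r 4 m] by (simp add: mult.commute)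
  then show ?thesis by (simp add: r power_int_divide_distrib)
qed

text \<open>Covers \<open>s_plus\<close>, \<open>s_minus\<close> and \<open>y_mode\<close> at once:
  each is a multiple \<open>c m\<close> of a Heisenberg mode, and the delta leaves only
  \<open>c m * c (- m)\<close> to compute.\<close>

lemma commutator_modes:
  assumes "m \<noteq> 0" "n \<noteq> 0"
  shows "commutator (normal_ordered q t p (smul (c m) (alpha m)))
      (normal_ordered q t p (smul (c n) (alpha n))) v =
    smul (c m * c (- m) * heis q t p m * (if m + n = 0 then 1 else 0)) v"
proof -
  have "commutator (normal_ordered q t p (smul (c m) (alpha m)))
      (normal_ordered q t p (smul (c n) (alpha n))) v =
      smul (c m * c n) (commutator (alpha_op q t p m) (alpha_op q t p n) v)"
    by (simp add: commutator_def normal_ordered_linear alpha_op_smul diff_conv_add_uminus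
        smul_add_right smul_minus_right mult.commute del: add_uminus_conv_diff)
  also have "\<dots> = smul (c m * c n * (heis q t p m * (if m + n = 0 then 1 else 0))) v"
    unfolding heis_def by (subst alpha_op_commutator) (use assms q t p powi_generic in auto)
  also have "\<dots> = smul (c m * c (- m) * heis q t p m * (if m + n = 0 then 1 else 0)) v"
    by (cases "m + n = 0") (auto simp: minus_unique)
  finally show ?thesis .
qed

text \<open>Vertex operators are encoded by their exponent coefficients with respect to
  \<open>alpha'\<close>. Products, inverses and rescalings then become sums, negatives and factors
  \<open>a powi (- m)\<close> on these coefficients.\<close>

abbreviation vertex :: "(int \<Rightarrow> complex) \<Rightarrow> symser" where
  "vertex c \<equiv> sym_exp (two_sided (\<lambda>m. smul (c m) (alpha' q t p r m)))"

lemma vertex_cong: "(\<And>m. m \<noteq> 0 \<Longrightarrow> c m = d m) \<Longrightarrow> vertex c = vertex d"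
  by (rule arg_cong[of _ _ sym_exp], rule two_sided_cong) simp

lemma vertex_mult: "vertex c * vertex d = vertex (\<lambda>m. c m + d m)"
  by (simp add: smul_add_left flip: sym_exp_add two_sided_add)

lemma vertex_prod: "(\<Prod>i\<in>I. vertex (c i)) = vertex (\<lambda>m. \<Sum>i\<in>I. c i m)"
  by (simp add: smul_sum_left flip: sym_exp_sum two_sided_sum)

lemma sym_inv_vertex: "sym_inv (vertex c) = vertex (\<lambda>m. - c m)"
  by (simp add: sym_inv_sym_exp two_sided_minus smul_minus_left)

lemma sym_arg_vertex: "sym_arg a (vertex c) = vertex (\<lambda>m. a powi (- m) * c m)"
  by (simp add: sym_arg_sym_exp sym_arg_two_sided)

lemma qt_powi: "(q / t) powi m = inverse ((t / q) powi m)"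
  by (simp add: power_int_divide_distrib)

section \<open>Exponent coefficients of the vertex operators\<close>

lemma x_minus_tilde_eq: "x_minus_tilde q t p r = vertex (\<lambda>m. r powi (- m) / (1 - (q / t) powi m))"
proof -
  have "smul (r powi (- m) / (1 - (q / t) powi m)) (alpha' q t p r m) =
      (if m < 0 then x_minus_cre q t p r (nat (- m)) else x_minus_ann q t p r (nat m))"
    if "m \<noteq> 0" for m
  proof (cases "m < 0")
    case True
    then have "r ^ nat (- m) = r powi (- m)" "(t / q) ^ nat (- m) = (q / t) powi m"
      by (simp_all add: power_int_def power_inverse[symmetric])
    with True show ?thesis by (simp add: x_minus_cre_def)
  next
    case False
    define R where "R = r powi m"
    have R: "R \<noteq> 0" "R ^ 4 \<noteq> 1" "(t / q) powi m = R ^ 4"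
      using r_nonzero r_powi[of m] powi_generic[OF that]
      by (auto simp: R_def power_int_divide_distrib)
    have *: "r ^ (3 * nat m) = R ^ 3" "(t / q) ^ nat m = R ^ 4"
      using False R(3) by (simp_all add: R_def power_int_def power_mult mult.commute[of 3])
    have "r powi (- m) / (1 - (q / t) powi m) = inverse R / (1 - inverse (R ^ 4))"
      by (simp add: qt_powi R(3)) (simp add: R_def power_int_minus)
    \<comment> \<open>Expanding by \<open>R ^ 4\<close> shows that the annihilation coefficient
      obeys the formula read off from the creation modes.\<close>
    also have "\<dots> = - (R ^ 3 / (1 - R ^ 4))"
      using R(1,2) by (simp add: divide_simps) (simp add: algebra_simps flip: power_Suc)
    finally show ?thesis using False by (simp add: x_minus_ann_def *)
  qed
  then show ?thesis
    by (simp add: x_minus_tilde_def sym_exp_pos_mult_neg cong: two_sided_cong)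
qed

text \<open>The opposite signs in the two exponents of \<open>Phi_empty\<close> are absorbed by the
  oddness of \<open>kappa\<close>.\<close>

lemma Phi_empty_eq: "Phi_empty q t p r = vertex (\<lambda>m. r powi (- 2 * m) / kappa q t m)"
proof -
  have "smul (r powi (- 2 * m) / kappa q t m) (alpha' q t p r m) =
      (if m < 0
       then smul (- (1 / kappa q t (int (nat (- m)))) * (r\<^sup>2) ^ nat (- m)) (alpha' q t p r (- int (nat (- m))))
       else smul (1 / kappa q t (int (nat m)) * inverse (r\<^sup>2) ^ nat m) (alpha' q t p r (int (nat m))))"
    for m
  proof -
    have "r powi (- 2 * m) = (r\<^sup>2) powi (- m)"
      using power_int_mult[of r 2 "- m"] by simp
    then show ?thesis
      using kappa_uminus[OF q t, of m]
      by (auto simp: power_int_def power_inverse)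
  qed
  then show ?thesis
    by (simp only: Phi_empty_def sym_exp_pos_mult_neg)
qed

lemma Phi_eq:
  "Phi q t p r l = vertex (\<lambda>m. r powi (- 2 * m) *
    (1 / kappa q t m + (\<Sum>b\<in>boxes l. qbox q t b powi m) / (1 - (q / t) powi m)))"
proof -
  have "(\<Prod>(i, j)\<in>boxes l. sym_arg (r * q powi (int j - 1) * t powi (- int i + 1)) (x_minus_tilde q t p r)) =
    (\<Prod>b\<in>boxes l. vertex (\<lambda>m. r powi (- 2 * m) * qbox q t b powi m / (1 - (q / t) powi m)))"
  proof (rule prod.cong[OF refl], clarify)
    fix i j
    have "q powi (int j - 1) = inverse (q powi (- int j + 1))"
      "t powi (- int i + 1) = inverse (t powi (int i - 1))"
      by (simp_all flip: power_int_minus)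
    then have "r * q powi (int j - 1) * t powi (- int i + 1) = r / qbox q t (i, j)"
      by (simp add: qbox_def divide_inverse)
    \<comment> \<open>The shift by \<open>r\<close> supplies a second factor
      \<open>r powi (- m)\<close>, so every box carries the same power of \<open>r\<close> as
      \<open>Phi_empty\<close>.\<close>
    moreover have "(r / x) powi (- m) * (r powi (- m) / d) = r powi (- 2 * m) * x powi m / d" for x d m
    proof -
      have *: "r powi (- 2 * m) = r powi (- m) * r powi (- m)"
        using r_nonzero by (simp flip: power_int_add)
      show ?thesis
        unfolding * power_int_divide_distrib power_int_minus by (simp add: divide_inverse)
    qed
    ultimately show "sym_arg (r * q powi (int j - 1) * t powi (- int i + 1)) (x_minus_tilde q t p r) =
      vertex (\<lambda>m. r powi (- 2 * m) * qbox q t (i, j) powi m / (1 - (q / t) powi m))"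
      by (simp only: x_minus_tilde_eq sym_arg_vertex)
  qed
  then show ?thesis
    by (simp add: Phi_def Phi_empty_eq vertex_prod vertex_mult ring_distribs
        sum_distrib_left sum_divide_distrib)
qed

text \<open>The shift of \<open>u\<close> by \<open>inverse p\<close> multiplies the coefficient by
  \<open>p powi m\<close> and inversion negates it, whence the factor
  \<open>1 - p powi m\<close>.\<close>

lemma Phi_dual_mult_Phi:
  "Phi_dual q t p r l * Phi q t p r l = vertex (\<lambda>m. (1 - p powi m) * (r powi (- 2 * m) *
    (1 / kappa q t m + (\<Sum>b\<in>boxes l. qbox q t b powi m) / (1 - (q / t) powi m))))"
proof -
  have "inverse p powi (- m) = p powi m" for m
    by (simp add: power_int_minus power_int_inverse)
  then show ?thesis
    by (simp add: Phi_dual_def Phi_eq sym_arg_vertex sym_inv_vertex vertex_mult left_diff_distrib)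
qed

lemma Y_corner_product:
  "(\<Prod>b\<in>A. sym_arg (1 / qbox q t b) (Y q t p r)) *
     (\<Prod>b\<in>B. sym_inv (sym_arg (q / t / qbox q t b) (Y q t p r))) =
   vertex (\<lambda>m. (1 - p powi m) / kappa q t m * r powi (- 2 * m) *
     ((\<Sum>b\<in>A. qbox q t b powi m) - (t / q) powi m * (\<Sum>b\<in>B. qbox q t b powi m)))"
proof -
  have Y: "Y q t p r = vertex (\<lambda>m. (1 - p powi m) / kappa q t m * r powi (- 2 * m))"
    unfolding Y_def y_mode_def by (rule refl)
  have x: "(1 / x) powi (- m) = x powi m" "(q / t / x) powi (- m) = (t / q) powi m * x powi m"
    for x m
    by (simp_all add: power_int_divide_distrib power_int_mult_distrib power_int_minus)
  have "(\<Sum>b\<in>A. f b * k) + (\<Sum>b\<in>B. - (w * f b * k)) = k * ((\<Sum>b\<in>A. f b) - w * (\<Sum>b\<in>B. f b))"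
    for f k and w :: complex
    by (simp add: sum_negf right_diff_distrib sum_distrib_left mult_ac)
  then show ?thesis
    by (simp only: Y sym_arg_vertex sym_inv_vertex vertex_prod vertex_mult x)
qed

text \<open>The corner identity at \<open>x = t powi m\<close>, \<open>y = q powi (- m)\<close>,
  where \<open>x * y = (t / q) powi m\<close>.\<close>

lemma qbox_identity:
  assumes l: "is_partition l"
  shows "(\<Sum>b\<in>addable l. qbox q t b powi m) - (t / q) powi m * (\<Sum>b\<in>removable l. qbox q t b powi m) =
    1 - (1 - t powi m) * (1 - q powi (- m)) * (\<Sum>b\<in>boxes l. qbox q t b powi m)"
proof -
  let ?w = "\<lambda>(i, j). (t powi m) ^ (i - 1) * (q powi (- m)) ^ (j - 1)"
  have w: "sum (\<lambda>b. qbox q t b powi m) S = sum ?w S" if "\<And>i j. (i, j) \<in> S \<Longrightarrow> i > 0 \<and> j > 0" for S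
  proof (rule sum.cong[OF refl])
    fix b assume "b \<in> S"
    with that show "qbox q t b powi m = ?w b"
      by (cases b) (simp add: qbox_powi)
  qed
  have "sum (\<lambda>b. qbox q t b powi m) (boxes l) = sum ?w (boxes l)"
    "sum (\<lambda>b. qbox q t b powi m) (addable l) = sum ?w (addable l)"
    "sum (\<lambda>b. qbox q t b powi m) (removable l) = sum ?w (removable l)"
    by (intro w; auto simp: mem_boxes addable_eq_image[OF l]
        removable_eq_image[OF l])+
  then show ?thesis
    using corner_identity[OF l, of "t powi m" "q powi (- m)"]
    by (simp only: divide_inverse power_int_mult_distrib power_int_inverse power_int_minus)
qed

lemma Phi_dual_mult_Phi_corners:
  assumes l: "is_partition l"
  shows "Phi_dual q t p r l * Phi q t p r l =
    (\<Prod>b\<in>addable l. sym_arg (1 / qbox q t b) (Y q t p r)) *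
      (\<Prod>b\<in>removable l. sym_inv (sym_arg (q / t / qbox q t b) (Y q t p r)))"
  unfolding Phi_dual_mult_Phi Y_corner_product qbox_identity[OF l]
proof (rule vertex_cong)
  fix m :: int assume m: "m \<noteq> 0"
  define S where "S = (\<Sum>b\<in>boxes l. qbox q t b powi m)"
  define Q T where "Q = q powi m" and "T = t powi m"
  have nz: "Q \<noteq> 0" "T \<noteq> 0" "Q \<noteq> 1" "T \<noteq> 1" "T \<noteq> Q"
    using q t powi_generic[OF m] by (auto simp: Q_def T_def power_int_divide_distrib)
  have kappa: "kappa q t m = (1 - Q) * (1 - inverse T) * (1 - T / Q)"
    by (simp add: kappa_def Q_def T_def power_int_minus power_int_divide_distrib)
  \<comment> \<open>Uses \<open>kappa q t m / (1 - Q / T) = - (1 - T) * (1 - inverse Q)\<close>,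
    which matches the box sum with that of the corner identity.\<close>
  have "1 / kappa q t m + S / (1 - Q / T) = (1 - (1 - T) * (1 - inverse Q) * S) / kappa q t m"
    unfolding kappa using nz by (simp add: divide_simps) (simp add: algebra_simps)
  then have "1 / kappa q t m + S / (1 - (q / t) powi m) =
      (1 - (1 - t powi m) * (1 - q powi (- m)) * S) / kappa q t m"
    by (simp add: Q_def T_def power_int_minus power_int_divide_distrib)
  then show "(1 - p powi m) * (r powi (- 2 * m) *
      (1 / kappa q t m + (\<Sum>b\<in>boxes l. qbox q t b powi m) / (1 - (q / t) powi m))) =
    (1 - p powi m) / kappa q t m * r powi (- 2 * m) *
      (1 - (1 - t powi m) * (1 - q powi (- m)) * (\<Sum>b\<in>boxes l. qbox q t b powi m))"
    unfolding S_def by simp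
qed

section \<open>The currents as screening currents\<close>

lemma s_minus_coeff:
  assumes "m \<noteq> 0"
  shows "r powi (- m) * (r powi (- m) / (1 - (q / t) powi m)) = - (r powi (2 * m) / (1 - (t / q) powi m))"
proof -
  define R where "R = r powi m"
  have R: "R \<noteq> 0" "R ^ 4 \<noteq> 1" "(t / q) powi m = R ^ 4"
    using r_nonzero r_powi[of m] powi_generic[OF assms]
    by (auto simp: R_def power_int_divide_distrib)
  have "r powi (- m) = inverse R" "r powi (2 * m) = R\<^sup>2"
    by (simp_all add: R_def power_int_minus mult.commute[of 2] power_int_mult)
  moreover have "inverse R * (inverse R / (1 - inverse (R ^ 4))) = - (R\<^sup>2 / (1 - R ^ 4))"
    using R(1,2) by (simp add: divide_simps) (simp add: power2_eq_square power4_eq_xxxx algebra_simps)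
  ultimately show ?thesis by (simp only: qt_powi R(3))
qed

lemma modes_in_alpha': "m \<in> S \<Longrightarrow> modes_in S (alpha' q t p r m)"
  by (simp add: alpha'_def modes_in_smul modes_in_alpha)

lemma x_minus_screening:
  "dist_arg r (x_minus q t p r N u) =
    dist_monom (inverse (r powi (2 * N) * u)) N (nord q t p (sym_exp (- two_sided (s_minus q t p r))))"
proof -
  have "op_product (op_exp (op_series q t p (x_minus_cre q t p r)))
      (op_exp (op_series q t p (x_minus_ann q t p r))) = nord q t p (x_minus_tilde q t p r)"
    unfolding x_minus_tilde_def
    by (rule op_product_op_exp)
       (simp_all add: x_minus_cre_def x_minus_ann_def modes_in_smul modes_in_alpha')
  \<comment> \<open>The shift of the argument by \<open>r\<close> balances the unequal weights
    \<open>r ^ n\<close> and \<open>r ^ (3 * n)\<close> of the two halves into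
    \<open>r powi (2 * m)\<close>.\<close>
  moreover have "sym_arg r (x_minus_tilde q t p r) = sym_exp (- two_sided (s_minus q t p r))"
    by (simp add: x_minus_tilde_eq sym_arg_vertex two_sided_minus s_minus_def s_minus_coeff
        smul_minus_left del: times_divide_eq_right cong: two_sided_cong)
  moreover have "inverse u * r powi (- 3 * N) * r powi N = inverse (r powi (2 * N) * u)"
  proof -
    have "r powi (- 3 * N) * r powi N = r powi (- (2 * N))"
      using r_nonzero by (simp flip: power_int_add)
    then show ?thesis by (simp add: power_int_minus)
  qed
  ultimately show ?thesis
    by (simp only: x_minus_def dist_arg_dist_monom[OF r_nonzero] dist_arg_nord[OF r_nonzero])
qed

lemma x_plus_screening:
  "dist_arg r (x_plus q t p r N u) =
    dist_monom (r powi (2 * N) * u) (-N) (nord q t p (sym_exp (two_sided (s_plus q t r))))"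
proof -
  define f g where "f n = smul (- (r ^ n / (1 - (t / q) ^ n))) (alpha (- int n))"
    and "g n = smul (r ^ (3 * n) / (1 - (t / q) ^ n)) (alpha (int n))" for n
  have "op_product (op_exp (op_series q t p f)) (op_exp (op_series q t p g)) =
      nord q t p (sym_exp (pos_series f) * sym_exp (neg_series g))"
    by (rule op_product_op_exp) (simp_all add: f_def g_def modes_in_smul modes_in_alpha)
  moreover have "sym_arg r (sym_exp (pos_series f) * sym_exp (neg_series g)) =
      sym_exp (two_sided (s_plus q t r))"
  proof -
    have "smul (r powi (- m)) (if m < 0 then f (nat (- m)) else g (nat m)) = s_plus q t r m"
      if "m \<noteq> 0" for m
    proof (cases "m < 0")
      case True
      then have "r ^ nat (- m) = r powi (- m)" "(t / q) ^ nat (- m) = (q / t) powi m"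
        by (simp_all add: power_int_def power_inverse[symmetric])
      \<comment> \<open>The creation weight in terms of \<open>alpha\<close> is minus that of
        \<open>x_minus_cre\<close> in terms of \<open>alpha'\<close>, so the same coefficient
        identity applies.\<close>
      with True s_minus_coeff[OF that] show ?thesis by (simp add: f_def s_plus_def)
    next
      case False
      then have "r ^ (3 * nat m) = r powi (3 * m)" "(t / q) ^ nat m = (t / q) powi m"
        by (simp_all add: power_int_def nat_mult_distrib)
      moreover have "r powi (- m) * r powi (3 * m) = r powi (2 * m)"
        using r_nonzero by (simp flip: power_int_add)
      ultimately show ?thesis using False by (simp add: g_def s_plus_def)
    qed
    then show ?thesis
      by (simp add: sym_exp_pos_mult_neg sym_arg_sym_exp sym_arg_two_sided cong: two_sided_cong)
  qed
  moreover have "u * r powi (3 * N) * r powi (- N) = r powi (2 * N) * u"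
  proof -
    have "r powi (3 * N) * r powi (- N) = r powi (2 * N)"
      using r_nonzero by (simp flip: power_int_add)
    then show ?thesis by simp
  qed
  ultimately show ?thesis
    by (simp only: x_plus_def dist_arg_dist_monom[OF r_nonzero] dist_arg_nord[OF r_nonzero]
        f_def[symmetric] g_def[symmetric])
qed

section \<open>Commutation relations of the modes\<close>

lemma commutator_s_plus:
  assumes "m \<noteq> 0" "n \<noteq> 0"
  shows "commutator (normal_ordered q t p (s_plus q t r m)) (normal_ordered q t p (s_plus q t r n)) v =
    smul (- (1 / of_int m) * ((1 - p powi m) / (1 - pstar q t p powi m))
      * (1 - q powi m) * (1 - t powi (-m)) * (if m + n = 0 then 1 else 0)) v"
proof -
  define c where "c k = r powi (2 * k) / (1 - (t / q) powi k)" for k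
  define X where "X = (t / q) powi m"
  have "r powi (2 * m) * r powi (2 * - m) = 1"
    using r_nonzero by (simp flip: power_int_add)
  then have "c m * c (- m) = 1 / ((1 - X) * (1 - inverse X))"
    by (simp add: c_def X_def power_int_minus)
  moreover have "X \<noteq> 0" "X \<noteq> 1" using powi_generic[OF assms(1)] q t by (auto simp: X_def)
  \<comment> \<open>The denominators cancel the factor \<open>1 - X\<close> of \<open>kappa\<close>
    and the factor \<open>1 - (q / t) powi m = 1 - inverse X\<close> of \<open>heis\<close>.\<close>
  ultimately have "c m * c (- m) * heis q t p m = - (1 / of_int m) *
      ((1 - p powi m) / (1 - pstar q t p powi m)) * (1 - q powi m) * (1 - t powi (-m))"
    by (simp add: heis_def kappa_def qt_powi flip: X_def)
  with commutator_modes[OF assms, of c v] show ?thesis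
    by (simp only: s_plus_def c_def)
qed

lemma commutator_s_minus:
  assumes "m \<noteq> 0" "n \<noteq> 0"
  shows "commutator (normal_ordered q t p (s_minus q t p r m)) (normal_ordered q t p (s_minus q t p r n)) v =
    smul (- (1 / of_int m) * ((1 - pstar q t p powi (-m)) / (1 - p powi (-m)))
      * (1 - q powi m) * (1 - t powi (-m)) * (if m + n = 0 then 1 else 0)) v"
proof -
  define c where "c k = r powi (2 * k) / (1 - (t / q) powi k) *
    ((1 - pstar q t p powi k) / (1 - p powi k) * r powi (2 * k))" for k
  define X P Ps where "X = (t / q) powi m" and "P = p powi m" and "Ps = pstar q t p powi m"
  \<comment> \<open>Regroups the product so that all powers of \<open>r\<close> meet their
    inverses.\<close>
  have "(a / x * (y * a)) * (b / x' * (z * b)) = a * b * (a * b) * (1 / (x * x') * (y * z))"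
    for a b x x' y z :: complex by simp
  moreover have "r powi (2 * m) * r powi (2 * - m) = 1"
    using r_nonzero by (simp flip: power_int_add)
  ultimately have "c m * c (- m) = 1 / ((1 - (t / q) powi m) * (1 - (t / q) powi (- m))) *
      ((1 - Ps) / (1 - P) * ((1 - pstar q t p powi (- m)) / (1 - p powi (- m))))"
    by (simp only: c_def P_def Ps_def mult_1)
  then have "c m * c (- m) = 1 / ((1 - X) * (1 - inverse X)) *
      ((1 - Ps) / (1 - P) * ((1 - pstar q t p powi (- m)) / (1 - p powi (- m))))"
    by (simp only: X_def power_int_minus)
  moreover have "X \<noteq> 0" "X \<noteq> 1" "P \<noteq> 1" "Ps \<noteq> 1"
    using powi_generic[OF assms(1)] q t by (auto simp: X_def P_def Ps_def)
  \<comment> \<open>The elliptic factor of \<open>heis\<close> cancels against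
    \<open>(1 - Ps) / (1 - P)\<close>, leaving the one at \<open>- m\<close>.\<close>
  ultimately have "c m * c (- m) * heis q t p m = - (1 / of_int m) *
      ((1 - pstar q t p powi (- m)) / (1 - p powi (- m))) * (1 - q powi m) * (1 - t powi (-m))"
    by (simp add: heis_def kappa_def qt_powi mult_ac flip: X_def P_def Ps_def)
  with commutator_modes[OF assms, of c v] show ?thesis
    by (simp only: s_minus_def alpha'_def smul_smul c_def)
qed

lemma commutator_y_mode:
  assumes "m \<noteq> 0" "n \<noteq> 0"
  shows "commutator (normal_ordered q t p (y_mode q t p r m)) (normal_ordered q t p (y_mode q t p r n)) v =
    smul (- (1 / of_int m) * ((1 - pstar q t p powi m) * (1 - p powi (-m)))
      / ((1 - q powi m) * (1 - t powi (-m))) * (if m + n = 0 then 1 else 0)) v"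
proof -
  define c where "c k = (1 - p powi k) / kappa q t k * r powi (- 2 * k) *
    ((1 - pstar q t p powi k) / (1 - p powi k) * r powi (2 * k))" for k
  define Q T P where "Q = q powi m" and "T = t powi m" and "P = p powi m"
  have c: "c k = (1 - pstar q t p powi k) / kappa q t k" if "k \<noteq> 0" for k
    using powi_generic[OF that] r_nonzero by (simp add: c_def power_int_minus)
  have Ps: "pstar q t p powi m = P * Q / T"
    by (simp add: pstar_def P_def Q_def T_def power_int_mult_distrib power_int_divide_distrib)
  have kappa: "kappa q t m = (1 - Q) * (1 - inverse T) * (1 - T / Q)"
    by (simp add: kappa_def Q_def T_def power_int_minus power_int_divide_distrib)
  have nz: "Q \<noteq> 0" "T \<noteq> 0" "P \<noteq> 0" "Q \<noteq> 1" "T \<noteq> 1" "T \<noteq> Q" "P * Q \<noteq> T"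
    using q t p powi_generic[OF assms(1)] Ps
    by (auto simp: Q_def T_def P_def power_int_divide_distrib)
  have "c m * c (- m) * heis q t p m =
      (1 - P * Q / T) / kappa q t m * ((1 - T / (P * Q)) / - kappa q t m) *
      (- (kappa q t m / of_int m) * (1 - Q / T) * ((1 - P) / (1 - P * Q / T)))"
    using assms(1) by (simp add: c heis_def Ps power_int_minus kappa_uminus[OF q t]
        power_int_divide_distrib flip: P_def Q_def T_def)
  also have "\<dots> = (1 - T / (P * Q)) * (1 - Q / T) * (1 - P) / (of_int m * kappa q t m)"
    using nz assms(1) by (simp add: kappa divide_simps)
  \<comment> \<open>Here \<open>(1 - Q / T) / (1 - T / Q) = - (Q / T)\<close>, while inverting the
    arguments of the two elliptic factors gives \<open>T / Q\<close>; only the sign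
    survives.\<close>
  also have "\<dots> = - (1 / of_int m) * ((1 - P * Q / T) * (1 - inverse P)) / ((1 - Q) * (1 - inverse T))"
    unfolding kappa using nz assms(1) by (simp add: divide_simps) (simp add: algebra_simps)
  finally have "c m * c (- m) * heis q t p m = - (1 / of_int m) *
      ((1 - pstar q t p powi m) * (1 - p powi (- m))) / ((1 - q powi m) * (1 - t powi (- m)))"
    by (simp add: Ps power_int_minus flip: P_def Q_def T_def)
  with commutator_modes[OF assms, of c v] show ?thesis
    by (simp only: y_mode_def alpha'_def smul_smul c_def)
qed

end

theorem mainTheorem16:
  fixes q t p r u :: complex and N :: int
  assumes "q \<noteq> 0" and "t \<noteq> 0" and "p \<noteq> 0" and "u \<noteq> 0"
    and "\<And>m::nat. m > 0 \<Longrightarrow> q ^ m \<noteq> 1"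
    and "\<And>m::nat. m > 0 \<Longrightarrow> t ^ m \<noteq> 1"
    and "\<And>m::nat. m > 0 \<Longrightarrow> (t / q) ^ m \<noteq> 1"
    and "norm p < 1" and "norm (p * q / t) < 1"
    and "r ^ 4 = t / q"
  shows
    "(\<forall>(m::int) (n::int) (v::fock). m \<noteq> 0 \<longrightarrow> n \<noteq> 0 \<longrightarrow>
       commutator (normal_ordered q t p (s_plus q t r m)) (normal_ordered q t p (s_plus q t r n)) v =
       smul (- (1 / of_int m) * ((1 - p powi m) / (1 - pstar q t p powi m))
              * (1 - q powi m) * (1 - t powi (-m)) * (if m + n = 0 then 1 else 0)) v) \<and>
     (\<forall>(m::int) (n::int) (v::fock). m \<noteq> 0 \<longrightarrow> n \<noteq> 0 \<longrightarrow>
       commutator (normal_ordered q t p (s_minus q t p r m)) (normal_ordered q t p (s_minus q t p r n)) v =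
       smul (- (1 / of_int m) * ((1 - pstar q t p powi (-m)) / (1 - p powi (-m)))
              * (1 - q powi m) * (1 - t powi (-m)) * (if m + n = 0 then 1 else 0)) v) \<and>
     (dist_arg r (x_plus q t p r N u) =
       dist_monom (r powi (2 * N) * u) (-N)
         (nord q t p (sym_exp (two_sided (s_plus q t r))))) \<and>
     (dist_arg r (x_minus q t p r N u) =
       dist_monom (inverse (r powi (2 * N) * u)) N
         (nord q t p (sym_exp (- two_sided (s_minus q t p r))))) \<and>
     (\<forall>(m::int) (n::int) (v::fock). m \<noteq> 0 \<longrightarrow> n \<noteq> 0 \<longrightarrow>
       commutator (normal_ordered q t p (y_mode q t p r m)) (normal_ordered q t p (y_mode q t p r n)) v =
       smul (- (1 / of_int m) * ((1 - pstar q t p powi m) * (1 - p powi (-m)))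
              / ((1 - q powi m) * (1 - t powi (-m))) * (if m + n = 0 then 1 else 0)) v) \<and>
     (\<forall>l::nat list. is_partition l \<longrightarrow>
       nord q t p (Phi_dual q t p r l * Phi q t p r l) =
       nord q t p ((\<Prod>b\<in>addable l. sym_arg (1 / qbox q t b) (Y q t p r))
                   * (\<Prod>b\<in>removable l. sym_inv (sym_arg (q / t / qbox q t b) (Y q t p r)))))"
proof -
  interpret generic_params q t p r
    using assms by unfold_locales auto
  show ?thesis
    \<comment> \<open>The vertex operator identity already holds between symbols, so it persists
      under \<open>nord\<close>.\<close>
    by (intro conjI allI impI commutator_s_plus commutator_s_minus x_plus_screening
        x_minus_screening commutator_y_mode arg_cong[of _ _ "nord q t p"] Phi_dual_mult_Phi_corners)
qed

end
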